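(* Let $G$ be a connected $k$-regular graph with $n$ vertices and $m$ unoriented edges, with $k>2$ and girth $g(G)>4$. Let $\mathbf{A}(G)$ be its adjacency matrix and $\mathbf{U}$ its Grover transition matrix. Then $(\mathbf{U}^3)^+$ has $2n$ eigenvalues $\lambda_3$ of the form $$\lambda_3=\frac12\Big\{\lambda_A(\lambda_A^2-3k+4)\pm\sqrt{\lambda_A^6-2(3k-2)\lambda_A^4+(13k^2-24k+16)\lambda_A^2-8(k-1)(k^2-2k+2)}\Big\},$$ where $\lambda_A$ is an eigenvalue of $\mathbf{A}(G)$. The remaining $2(m-n)$ eigenvalues of $(\mathbf{U}^3)^+$ are $\pm2$, each with multiplicity $m-n$.
   Context: Graphs are finite and may have multiple edges and loops. $D(G)=\{(u,v),(v,u)\mid uv\in E(G)\}$ is the set of arcs, two mutually inverse arcs for each edge; for an arc $e=(u,v)$ put $o(e)=u$, $t(e)=v$, $e^{-1}=(v,u)$. The degree $d_v=\deg v$ is the number of edges incident to $v$; $G$ is $k$-regular if $\deg v=k$ for every vertex $v$. A cycle is a sequence $C=(v_0,e_1,v_1,\dots,v_{s-1},e_s,v_s)$ with $e_i\in D(G)$, $o(e_i)=v_{i-1}$, $t(e_i)=v_i$ and $v_0=v_s$; it is reduced if $e_{i+1}^{-1}\neq e_i$ for $1\le i\le s-1$. A (reduced) cycle is essential if all its vertices except $v_0,v_s$ are distinct and $s\ge2$. The girth $g(G)$ is the minimum length $s$ of essential cycles in $G$. The Grover transition matrix $\mathbf{U}=(U_{ef})_{e,f\in D(G)}$ is defined by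 $U_{ef}=2/d_{t(f)}$ if $t(f)=o(e)$ and $f\ne e^{-1}$; $U_{ef}=2/d_{t(f)}-1$ if $f=e^{-1}$; and $U_{ef}=0$ otherwise. The positive support $\mathbf{F}^+$ of a real square matrix $\mathbf{F}$ has $F^+_{ij}=1$ if $F_{ij}>0$ and $0$ otherwise. Eigenvalues are counted with multiplicity, and square roots are complex square roots. *)

theory Defs
  imports
    "HOL-Library.Extended_Nat"
    "Graph_Theory.Graph_Theory"
    "Jordan_Normal_Form.Char_Poly"
begin

text \<open>
  A graph with multiple edges and loops is given by its symmetric digraph: a bidirected digraph
  \<open>G\<close> with the fixed-point free involution \<open>arev\<close> on its arcs. The arc set \<open>arcs G\<close> is $D(G)$,
  \<open>tail G\<close> and \<open>head G\<close> are the origin $o$ and the terminus $t$, \<open>arev e\<close> is $e^{-1}$, and an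
  unoriented edge is an orbit \<open>{e, arev e}\<close>.
\<close>

definition uedges :: "('a, 'b) pre_digraph \<Rightarrow> ('b \<Rightarrow> 'b) \<Rightarrow> 'b set set" where
  "uedges G arev = (\<lambda>e. {e, arev e}) ` arcs G"

text \<open>
  A loop is a single edge incident to its vertex and so counts once. The convention chosen for
  loops has no effect on graphs of girth greater than 2, which have no loops (see below).
\<close>
definition deg :: "('a, 'b) pre_digraph \<Rightarrow> ('b \<Rightarrow> 'b) \<Rightarrow> 'a \<Rightarrow> nat" where
  "deg G arev v = card {x \<in> uedges G arev. \<exists>e\<in>x. tail G e = v \<or> head G e = v}"

definition k_regular :: "('a, 'b) pre_digraph \<Rightarrow> ('b \<Rightarrow> 'b) \<Rightarrow> nat \<Rightarrow> bool" where
  "k_regular G arev k \<longleftrightarrow> (\<forall>v\<in>verts G. deg G arev v = k)"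

definition reduced :: "('b \<Rightarrow> 'b) \<Rightarrow> 'b list \<Rightarrow> bool" where
  "reduced arev p \<longleftrightarrow> (\<forall>i. Suc i < length p \<longrightarrow> arev (p ! Suc i) \<noteq> p ! i)"

text \<open>
  With \<open>awalk_verts G u p = [v\<^sub>0, \<dots>, v\<^sub>s]\<close>, the distinctness condition concerns the vertices
  $v_1, \dots, v_{s-1}$. A loop \<open>e\<close> yields the essential cycle \<open>[e, e]\<close> of length 2, and a pair of
  parallel edges yields one as well.
\<close>
definition essential_cycle :: "('a, 'b) pre_digraph \<Rightarrow> ('b \<Rightarrow> 'b) \<Rightarrow> 'b list \<Rightarrow> bool" where
  "essential_cycle G arev p \<longleftrightarrow>
     (\<exists>u. pre_digraph.awalk G u p u \<and> reduced arev p \<and>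
          distinct (butlast (tl (pre_digraph.awalk_verts G u p))) \<and> length p \<ge> 2)"

definition girth :: "('a, 'b) pre_digraph \<Rightarrow> ('b \<Rightarrow> 'b) \<Rightarrow> enat" where
  "girth G arev = (INF p\<in>{p. essential_cycle G arev p}. enat (length p))"

text \<open>
  Matrices are indexed by positions in an enumeration \<open>vs\<close> of the vertices, respectively \<open>es\<close> of
  the arcs.
\<close>

definition adjacency_mat :: "('a, 'b) pre_digraph \<Rightarrow> 'a list \<Rightarrow> real mat" where
  "adjacency_mat G vs = mat (length vs) (length vs)
     (\<lambda>(i, j). real (card {e \<in> arcs G. tail G e = vs ! i \<and> head G e = vs ! j}))"

definition grover_entry :: "('a, 'b) pre_digraph \<Rightarrow> ('b \<Rightarrow> 'b) \<Rightarrow> 'b \<Rightarrow> 'b \<Rightarrow> real" where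
  "grover_entry G arev e f =
     (if head G f = tail G e \<and> f \<noteq> arev e then 2 / real (deg G arev (head G f))
      else if f = arev e then 2 / real (deg G arev (head G f)) - 1
      else 0)"

definition grover_mat :: "('a, 'b) pre_digraph \<Rightarrow> ('b \<Rightarrow> 'b) \<Rightarrow> 'b list \<Rightarrow> real mat" where
  "grover_mat G arev es = mat (length es) (length es)
     (\<lambda>(i, j). grover_entry G arev (es ! i) (es ! j))"

definition pos_support :: "real mat \<Rightarrow> real mat" where
  "pos_support F = map_mat (\<lambda>x. if x > 0 then 1 else 0) F"

text \<open>The complex eigenvalues of a square matrix, with algebraic multiplicity.\<close>
definition eigenvalues :: "real mat \<Rightarrow> complex multiset" where
  "eigenvalues M = proots (char_poly (map_mat complex_of_real M))"

end

theory Submission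
  imports Defs "Jordan_Normal_Form.Schur_Decomposition"
begin

text \<open>
  Put $a = 2/k$ and let $O$, $T$ be the arc-vertex incidence matrices of origins and termini and $J$
  the permutation matrix of the arc reversal. Then $U = a O T^T - J$, and expanding $U^3$ with
  $a k = 2$ gives its entries in terms of adjacency and of the number of 2-step walks. A girth
  above 4 forbids loops, parallel edges and 4-cycles, so that a case distinction yields
  $(U^3)^+ = O Z_1 + T Z_2 - 2J$ with $Z_1, Z_2$ linear in $O^T$, $T^T$ over polynomials in $A$.
  As $J$ swaps the columns of $O$ and $T$, the block identity
  $\det (X - WZ) \det Y = \det X \det (Y - ZW)$ for $XW = WY$, applied to $W = (O, T)$ and
  $X = x + 2J$, turns the characteristic polynomial of $(U^3)^+$ into $(x^2-4)^{m-n}$ times a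
  $2n \times 2n$ determinant whose blocks are polynomials in $A$. Triangularising $A$ factors
  the latter into one quadratic in $x$ for each eigenvalue of $A$.
\<close>

section \<open>Determinants of block and low-rank-perturbed matrices\<close>

text \<open>The bordered matrix with blocks \<open>X\<close>, \<open>W\<close>, \<open>Z\<close>,
  \<open>1\<close> is multiplied from the right in two ways. A unimodular factor exposes
  \<open>X - W * Z\<close>; the factor with last block column \<open>- W\<close>, \<open>Y\<close>
  clears the upper right block exactly because \<open>X * W = W * Y\<close>. Nothing is inverted, so
  singular \<open>X\<close> and \<open>Y\<close> are covered.\<close>

lemma det_update_intertwined:
  fixes X :: "'a::idom mat"
  assumes X: "X \<in> carrier_mat N N" and W: "W \<in> carrier_mat N r"
    and Z: "Z \<in> carrier_mat r N" and Y: "Y \<in> carrier_mat r r"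
    and XW: "X * W = W * Y"
  shows "det (X - W * Z) * det Y = det X * det (Y - Z * W)"
proof -
  let ?P = "four_block_mat X W Z (1\<^sub>m r)"
  let ?L = "four_block_mat (1\<^sub>m N) (0\<^sub>m N r) (- Z) (1\<^sub>m r)"
  let ?R = "four_block_mat (1\<^sub>m N) (- W) (0\<^sub>m r N) Y"
  have P: "?P \<in> carrier_mat (N + r) (N + r)" using X by auto
  have L: "?L \<in> carrier_mat (N + r) (N + r)" by auto
  have R: "?R \<in> carrier_mat (N + r) (N + r)" using Y by auto
  have XWZ: "X - W * Z \<in> carrier_mat N N" and YZW: "Y - Z * W \<in> carrier_mat r r"
    using W Z by (auto simp: minus_carrier_mat)
  have "?P * ?L = four_block_mat (X - W * Z) W (0\<^sub>m r N) (1\<^sub>m r)"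
    by (subst mult_four_block_mat[OF X W Z one_carrier_mat])
       (use X W Z in \<open>auto intro!: cong_four_block_mat simp: minus_add_uminus_mat[of _ N N]\<close>)
  then have "det (?P * ?L) = det (X - W * Z)"
    using det_four_block_mat_lower_left_zero[of "X - W * Z" N W r "0\<^sub>m r N" "1\<^sub>m r"] W Z XWZ by auto
  moreover have "det ?L = 1"
    using det_four_block_mat_upper_right_zero[of "1\<^sub>m N" N "0\<^sub>m N r" r "- Z" "1\<^sub>m r"] Z by auto
  ultimately have detP: "det ?P = det (X - W * Z)" using det_mult[OF P L] by simp
  have "?P * ?R = four_block_mat X (0\<^sub>m N r) Z (Y - Z * W)"
    by (subst mult_four_block_mat[OF X W Z one_carrier_mat])
       (use X W Z Y XW in \<open>auto intro!: cong_four_block_mat simp: minus_add_uminus_mat[of _ r r]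
          uminus_l_inv_mat comm_add_mat[of _ r r]\<close>)
  then have "det (?P * ?R) = det X * det (Y - Z * W)"
    using det_four_block_mat_upper_right_zero[of X N "0\<^sub>m N r" r Z "Y - Z * W"] X Z YZW by auto
  moreover have "det ?R = det Y"
    using det_four_block_mat_lower_left_zero[of "1\<^sub>m N" N "- W" r "0\<^sub>m r N" Y] W Y by auto
  ultimately show ?thesis using det_mult[OF P R] detP by simp
qed

lemma minus_four_block_mat:
  assumes "A1 \<in> carrier_mat nr1 nc1" "B1 \<in> carrier_mat nr1 nc2"
    "C1 \<in> carrier_mat nr2 nc1" "D1 \<in> carrier_mat nr2 nc2"
    "A2 \<in> carrier_mat nr1 nc1" "B2 \<in> carrier_mat nr1 nc2"
    "C2 \<in> carrier_mat nr2 nc1" "D2 \<in> carrier_mat nr2 nc2"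
  shows "four_block_mat A1 B1 C1 D1 - four_block_mat A2 B2 C2 D2 =
    four_block_mat (A1 - A2) (B1 - B2) (C1 - C2) (D1 - D2)"
  using assms by (intro eq_matI) auto

text \<open>Allows identities between characteristic polynomials to be proved by evaluating
  determinants point by point.\<close>

lemma poly_char_poly:
  fixes M :: "'a::field mat"
  assumes "M \<in> carrier_mat n n"
  shows "poly (char_poly M) x = det (x \<cdot>\<^sub>m 1\<^sub>m n - M)"
proof -
  have "- char_matrix M x = x \<cdot>\<^sub>m 1\<^sub>m n - M"
    using assms by (auto simp: char_matrix_def)
  then show ?thesis using char_poly_matrix[OF assms] by simp
qed

section \<open>Simultaneous triangularisation under a fixed similarity\<close>

lemma upper_triangular_mult:
  fixes A B :: "'a::semiring_0 mat"
  assumes A: "A \<in> carrier_mat n n" and B: "B \<in> carrier_mat n n"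
    and uA: "upper_triangular A" and uB: "upper_triangular B"
  shows "upper_triangular (A * B)"
    and "i < n \<Longrightarrow> (A * B) $$ (i, i) = A $$ (i, i) * B $$ (i, i)"
proof -
  have z: "A $$ (i, h) * B $$ (h, j) = 0" if "i < n" "h < n" "h < i \<or> j < h" for i j h
    using that uA uB A B by (auto simp: upper_triangular_def)
  have e: "(A * B) $$ (i, j) = (\<Sum>h = 0..<n. A $$ (i, h) * B $$ (h, j))" if "i < n" "j < n" for i j
    using that A B by (simp add: scalar_prod_def)
  show "upper_triangular (A * B)"
    unfolding upper_triangular_def
  proof (intro allI impI)
    fix i j assume ij: "i < dim_row (A * B)" "j < i"
    then have i: "i < n" "j < n" using A by auto
    show "(A * B) $$ (i, j) = 0"
      unfolding e[OF i] by (intro sum.neutral ballI z) (use i ij in auto)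
  qed
  show "(A * B) $$ (i, i) = A $$ (i, i) * B $$ (i, i)" if i: "i < n"
  proof -
    have "(A * B) $$ (i, i) = (\<Sum>h \<in> {i}. A $$ (i, h) * B $$ (h, i))"
      unfolding e[OF i i] by (intro sum.mono_neutral_right ballI z) (use i in auto)
    then show ?thesis by simp
  qed
qed

locale similarity =
  fixes n :: nat and P Q :: "'a::field mat"
  assumes P: "P \<in> carrier_mat n n" and Q: "Q \<in> carrier_mat n n"
    and PQ: "P * Q = 1\<^sub>m n" and QP: "Q * P = 1\<^sub>m n"
begin

text \<open>The matrices that one fixed conjugation makes triangular form an algebra, and the
  diagonal \<open>f\<close> is multiplicative on it. Tracking \<open>f\<close> evaluates a
  polynomial in a triangularised matrix at its eigenvalues.\<close>

definition tri :: "'a mat \<Rightarrow> (nat \<Rightarrow> 'a) \<Rightarrow> bool" where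
  "tri X f \<longleftrightarrow> X \<in> carrier_mat n n \<and> upper_triangular (Q * X * P) \<and>
     (\<forall>i<n. (Q * X * P) $$ (i, i) = f i)"

lemma tri_carrier: "tri X f \<Longrightarrow> X \<in> carrier_mat n n"
  by (simp add: tri_def)

lemma tri_one: "tri (1\<^sub>m n) (\<lambda>_. 1)"
  using P Q QP by (auto simp: tri_def)

lemma tri_smult:
  assumes "tri X f" shows "tri (c \<cdot>\<^sub>m X) (\<lambda>i. c * f i)"
proof -
  have X: "X \<in> carrier_mat n n" using assms by (rule tri_carrier)
  have "Q * (c \<cdot>\<^sub>m X) * P = c \<cdot>\<^sub>m (Q * X * P)"
    using P Q X by (simp add: mult_smult_distrib[of Q n n] mult_smult_assoc_mat[of _ n n])
  then show ?thesis using assms P Q by (auto simp: tri_def upper_triangular_def)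
qed

lemma tri_minus:
  assumes "tri X f" "tri Y g" shows "tri (X - Y) (\<lambda>i. f i - g i)"
proof -
  have c: "X \<in> carrier_mat n n" "Y \<in> carrier_mat n n" using assms by (auto intro: tri_carrier)
  have "Q * (X - Y) * P = Q * X * P - Q * Y * P"
    using P Q c by (simp add: mult_minus_distrib_mat[of Q n n] minus_mult_distrib_mat[of _ n n])
  then show ?thesis using assms P Q c by (auto simp: tri_def upper_triangular_def)
qed

lemma tri_mult:
  assumes "tri X f" "tri Y g" shows "tri (X * Y) (\<lambda>i. f i * g i)"
proof -
  have c: "X \<in> carrier_mat n n" "Y \<in> carrier_mat n n" using assms by (auto intro: tri_carrier)
  have "Q * X * P * (Q * Y * P) = Q * X * (P * Q) * Y * P"
    using P Q c by (simp add: assoc_mult_mat[of _ n n _ n _ n] del: PQ QP)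
  also have "\<dots> = Q * (X * Y) * P"
    using P Q c by (simp add: PQ assoc_mult_mat[of _ n n _ n _ n])
  finally have "Q * (X * Y) * P = Q * X * P * (Q * Y * P)" ..
  then show ?thesis
    using assms P Q c upper_triangular_mult[of "Q * X * P" n "Q * Y * P"] by (auto simp: tri_def)
qed

lemma det_tri:
  assumes "tri X f" shows "det X = (\<Prod>i<n. f i)"
proof -
  have X: "X \<in> carrier_mat n n" using assms by (rule tri_carrier)
  have c: "Q * X * P \<in> carrier_mat n n" using P Q X by auto
  have "det (Q * X * P) = det X * (det P * det Q)"
    using P Q X by (simp add: det_mult[of _ n])
  also have "det P * det Q = 1" using det_mult[OF P Q] by (simp add: PQ)
  finally have "det X = prod_list (diag_mat (Q * X * P))"
    using det_upper_triangular[OF _ c] assms by (simp add: tri_def)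
  also have "\<dots> = (\<Prod>i<n. (Q * X * P) $$ (i, i))"
    using P Q by (simp add: prod_list_diag_prod atLeast0LessThan)
  also have "\<dots> = (\<Prod>i<n. f i)" using assms by (simp add: tri_def)
  finally show ?thesis .
qed

end

text \<open>Conjugation by signs gives \<open>x + c J\<close> and \<open>x - c J\<close> the same
  determinant, and their product is \<open>x^2 - c^2\<close> times the identity. So the square of
  the determinant is known, and monicity fixes the sign. This avoids reordering the indices into 2
  by 2 blocks.\<close>

lemma det_fixpoint_free_involution:
  fixes c :: complex
  assumes s: "\<And>i. i < 2 * m \<Longrightarrow> s i < 2 * m \<and> s (s i) = i \<and> s i \<noteq> i"
  defines "J \<equiv> mat (2 * m) (2 * m) (\<lambda>(i, j). of_bool (j = s i))"
  shows "det (x \<cdot>\<^sub>m 1\<^sub>m (2 * m) + c \<cdot>\<^sub>m J) = (x\<^sup>2 - c\<^sup>2) ^ m"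
proof -
  let ?N = "2 * m"
  have J: "J \<in> carrier_mat ?N ?N" by (simp add: J_def)
  define p where "p = char_poly (- c \<cdot>\<^sub>m J)"
  define q where "q = [:- (c\<^sup>2), 0, 1:] ^ m"
  have p: "poly p x = det (x \<cdot>\<^sub>m 1\<^sub>m ?N + c \<cdot>\<^sub>m J)" for x
  proof -
    have "x \<cdot>\<^sub>m 1\<^sub>m ?N - (- c \<cdot>\<^sub>m J) = x \<cdot>\<^sub>m 1\<^sub>m ?N + c \<cdot>\<^sub>m J"
      using J by (intro eq_matI) auto
    then show ?thesis
      unfolding p_def using poly_char_poly[of "- c \<cdot>\<^sub>m J" ?N x] J by simp
  qed
  \<comment> \<open>An orientation of the orbits: conjugation by the sign matrix \<open>D\<close> turns \<open>J\<close> into \<open>- J\<close>.\<close>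
  define D :: "complex mat" where "D = mat ?N ?N (\<lambda>(i, j). if i = j then (if i < s i then 1 else - 1) else 0)"
  have D: "D \<in> carrier_mat ?N ?N" by (simp add: D_def)
  have pp: "poly p x * poly p x = (x\<^sup>2 - c\<^sup>2) ^ ?N" for x
  proof -
    let ?X = "x \<cdot>\<^sub>m 1\<^sub>m ?N + c \<cdot>\<^sub>m J" and ?X' = "x \<cdot>\<^sub>m 1\<^sub>m ?N - c \<cdot>\<^sub>m J"
    have X: "?X \<in> carrier_mat ?N ?N" "?X' \<in> carrier_mat ?N ?N" using J by auto
    have JJ: "J * J = 1\<^sub>m ?N"
    proof (rule eq_matI)
      fix i j assume ij: "i < dim_row (1\<^sub>m ?N)" "j < dim_col (1\<^sub>m ?N)"
      then have "(J * J) $$ (i, j) = (\<Sum>h = 0..<?N. of_bool (h = s i) * of_bool (j = s h))"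
        by (simp add: J_def scalar_prod_def)
      also have "\<dots> = (\<Sum>h \<in> {s i}. of_bool (h = s i) * of_bool (j = s h))"
        using ij s by (intro sum.mono_neutral_right) auto
      finally show "(J * J) $$ (i, j) = 1\<^sub>m ?N $$ (i, j)" using ij s[of i] by auto
    qed (auto simp: J_def)
    have XX: "?X * ?X' = (x\<^sup>2 - c\<^sup>2) \<cdot>\<^sub>m 1\<^sub>m ?N"
    proof -
      have "?X * ?X' = x \<cdot>\<^sub>m 1\<^sub>m ?N * (x \<cdot>\<^sub>m 1\<^sub>m ?N) - x \<cdot>\<^sub>m 1\<^sub>m ?N * (c \<cdot>\<^sub>m J)
          + (c \<cdot>\<^sub>m J * (x \<cdot>\<^sub>m 1\<^sub>m ?N) - c \<cdot>\<^sub>m J * (c \<cdot>\<^sub>m J))"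
        using J X by (subst add_mult_distrib_mat[of _ ?N ?N _ _ ?N])
          (auto simp: mult_minus_distrib_mat[of _ ?N ?N _ ?N])
      also have "\<dots> = (x * x) \<cdot>\<^sub>m 1\<^sub>m ?N - (x * c) \<cdot>\<^sub>m J + ((c * x) \<cdot>\<^sub>m J - (c * c) \<cdot>\<^sub>m 1\<^sub>m ?N)"
        using J by (simp add: mult_smult_distrib[of _ ?N ?N _ ?N] mult_smult_assoc_mat[of _ ?N ?N _ ?N] JJ, intro eq_matI) auto
      also have "\<dots> = (x\<^sup>2 - c\<^sup>2) \<cdot>\<^sub>m 1\<^sub>m ?N"
        using J by (intro eq_matI) (auto simp: power2_eq_square algebra_simps)
      finally show ?thesis .
    qed
    \<comment> \<open>An off-diagonal entry joins \<open>i\<close> to \<open>s i\<close>; exactly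
      one of these two is smaller than its image, so their signs in \<open>D\<close> are
      opposite.\<close>
    have DX: "D * ?X = ?X' * D"
    proof (rule eq_matI)
      fix i j assume "i < dim_row (?X' * D)" "j < dim_col (?X' * D)"
      then have ij: "i < ?N" "j < ?N" using J D by auto
      have "(D * ?X) $$ (i, j) = (\<Sum>h = 0..<?N. D $$ (i, h) * ?X $$ (h, j))"
        using ij J D by (simp add: scalar_prod_def)
      also have "\<dots> = (\<Sum>h \<in> {i}. D $$ (i, h) * ?X $$ (h, j))"
        using ij J by (intro sum.mono_neutral_right) (auto simp: D_def)
      finally have 1: "(D * ?X) $$ (i, j) = D $$ (i, i) * ?X $$ (i, j)" by simp
      have "(?X' * D) $$ (i, j) = (\<Sum>h = 0..<?N. ?X' $$ (i, h) * D $$ (h, j))"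
        using ij J D by (simp add: scalar_prod_def)
      also have "\<dots> = (\<Sum>h \<in> {j}. ?X' $$ (i, h) * D $$ (h, j))"
        using ij J by (intro sum.mono_neutral_right) (auto simp: D_def)
      finally have 2: "(?X' * D) $$ (i, j) = ?X' $$ (i, j) * D $$ (j, j)" by simp
      show "(D * ?X) $$ (i, j) = (?X' * D) $$ (i, j)"
        unfolding 1 2 using ij s[of i] s[of j] by (auto simp: D_def J_def)
    qed (use J D in auto)
    have "D * D = 1\<^sub>m ?N"
    proof (rule eq_matI)
      fix i j assume ij: "i < dim_row (1\<^sub>m ?N)" "j < dim_col (1\<^sub>m ?N)"
      then have "(D * D) $$ (i, j) = (\<Sum>h = 0..<?N. D $$ (i, h) * D $$ (h, j))"
        using D by (simp add: scalar_prod_def)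
      also have "\<dots> = (\<Sum>h \<in> {i}. D $$ (i, h) * D $$ (h, j))"
        using ij by (intro sum.mono_neutral_right) (auto simp: D_def)
      finally show "(D * D) $$ (i, j) = 1\<^sub>m ?N $$ (i, j)" using ij by (auto simp: D_def)
    qed (auto simp: D_def)
    then have "det D \<noteq> 0" using det_mult[OF D D] by auto
    moreover have "det D * det ?X = det ?X' * det D"
      using det_mult[OF D X(1)] det_mult[OF X(2) D] unfolding DX by (simp only:)
    ultimately have "det ?X = det ?X'" by simp
    then have "poly p x * poly p x = det (?X * ?X')"
      using det_mult[OF X] p by simp
    then show ?thesis unfolding XX by (simp add: det_smult)
  qed
  have deg: "degree p = ?N \<and> lead_coeff p = 1"
    unfolding p_def using degree_monic_char_poly[of "- c \<cdot>\<^sub>m J" ?N] J by auto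
  have q1: "lead_coeff q = 1" by (simp add: q_def lead_coeff_power)
  have q: "poly q x = (x\<^sup>2 - c\<^sup>2) ^ m" for x
    by (simp add: q_def power2_eq_square algebra_simps)
  \<comment> \<open>Pointwise evaluation determines only the square; since \<open>p\<close> and
    \<open>q\<close> both have leading coefficient 1, the case \<open>p = - q\<close> is
    excluded.\<close>
  have "p * p = q * q"
    by (rule poly_ext) (simp add: pp q power_add[symmetric] mult_2)
  then have "(p - q) * (p + q) = 0" by (simp add: algebra_simps)
  moreover have "p \<noteq> - q"
    using deg q1 by (metis lead_coeff_minus one_neq_neg_one)
  ultimately have "p = q" by (auto simp: add_eq_0_iff)
  then show ?thesis using p q by simp
qed

section \<open>Three steps of the Grover walk on an indexed graph\<close>

text \<open>Arcs and vertices are natural numbers, so that they serve directly as matrix indices.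
  The girth bound enters as the absence of cycles of length 1, 2 and 4; \<open>no_square\<close>
  says that two vertices at the ends of a 2-step walk determine its midpoint.\<close>

locale indexed_graph =
  fixes m n k :: nat and org ter rv :: "nat \<Rightarrow> nat"
  assumes org_less: "e < 2 * m \<Longrightarrow> org e < n"
    and rv_less: "e < 2 * m \<Longrightarrow> rv e < 2 * m"
    and rv_rv: "e < 2 * m \<Longrightarrow> rv (rv e) = e"
    and org_rv: "e < 2 * m \<Longrightarrow> org (rv e) = ter e"
    and out_degree: "v < n \<Longrightarrow> card {e. e < 2 * m \<and> org e = v} = k"
    and degree_gt: "k > 2"
    and no_loop: "e < 2 * m \<Longrightarrow> org e \<noteq> ter e"
    and no_parallel: "e < 2 * m \<Longrightarrow> f < 2 * m \<Longrightarrow> org e = org f \<Longrightarrow> ter e = ter f \<Longrightarrow> e = f"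
    and no_square: "a < 2 * m \<Longrightarrow> b < 2 * m \<Longrightarrow> c < 2 * m \<Longrightarrow> d < 2 * m \<Longrightarrow>
      ter a = org b \<Longrightarrow> ter c = org d \<Longrightarrow> org a = org c \<Longrightarrow> ter b = ter d \<Longrightarrow> org a \<noteq> ter b \<Longrightarrow>
      ter a = ter c"
begin

lemma ter_rv: "e < 2 * m \<Longrightarrow> ter (rv e) = org e"
  using org_rv[of "rv e"] rv_less rv_rv by simp

lemma ter_less: "e < 2 * m \<Longrightarrow> ter e < n"
  using org_less[of "rv e"] rv_less org_rv by simp

lemma rv_neq: "e < 2 * m \<Longrightarrow> rv e \<noteq> e"
  using no_loop[of e] org_rv[of e] by auto

lemma rv_eq_iff: "e < 2 * m \<Longrightarrow> f < 2 * m \<Longrightarrow> rv e = rv f \<longleftrightarrow> e = f"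
  by (metis rv_rv)

section \<open>Adjacency and walks of length two\<close>

definition adj :: "nat \<Rightarrow> nat \<Rightarrow> bool" where
  "adj u v \<longleftrightarrow> (\<exists>e < 2 * m. org e = u \<and> ter e = v)"

lemma adj_sym: "adj u v \<longleftrightarrow> adj v u"
  unfolding adj_def by (metis org_rv ter_rv rv_less)

lemma adj_arc: "e < 2 * m \<Longrightarrow> adj (org e) (ter e)" "e < 2 * m \<Longrightarrow> adj (ter e) (org e)"
  unfolding adj_def by (blast, metis org_rv ter_rv rv_less)

lemma adj_less: "adj u v \<Longrightarrow> u < n" "adj u v \<Longrightarrow> v < n"
  using org_less ter_less by (auto simp: adj_def)

lemma adj_square:
  assumes "adj u p" "adj p v" "adj u r" "adj r v" "u \<noteq> v"
  shows "p = r"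
proof -
  obtain a where a: "a < 2 * m" "org a = u" "ter a = p" using assms(1) unfolding adj_def by blast
  obtain b where b: "b < 2 * m" "org b = p" "ter b = v" using assms(2) unfolding adj_def by blast
  obtain c where c: "c < 2 * m" "org c = u" "ter c = r" using assms(3) unfolding adj_def by blast
  obtain d where d: "d < 2 * m" "org d = r" "ter d = v" using assms(4) unfolding adj_def by blast
  show ?thesis using no_square[of a b c d] a b c d assms(5) by simp
qed

text \<open>Counting midpoints counts walks, because there are no parallel arcs; these numbers are
  the entries of \<open>A^2\<close>.\<close>

definition walks2 :: "nat \<Rightarrow> nat \<Rightarrow> nat" where
  "walks2 u w = card {v. adj u v \<and> adj v w}"

abbreviation ins :: "nat \<Rightarrow> nat set" where
  "ins v \<equiv> {h. h < 2 * m \<and> ter h = v}"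

text \<open>Without parallel arcs, an arc into \<open>u\<close> is determined by its origin, which
  runs through the neighbours of \<open>u\<close>. Sums over incoming arcs thereby become counts of
  neighbours.\<close>

lemma card_arcs_with_org:
  assumes "\<And>h. h < 2 * m \<Longrightarrow> P h \<longleftrightarrow> Q (org h)"
  shows "card {h \<in> ins u. P h} = card {v. adj u v \<and> Q v}"
proof (rule bij_betw_same_card[of org])
  show "bij_betw org {h \<in> ins u. P h} {v. adj u v \<and> Q v}"
    unfolding bij_betw_def
  proof
    show "inj_on org {h \<in> ins u. P h}"
      by (rule inj_onI) (rule no_parallel, auto)
    have nb: "adj u v \<longleftrightarrow> (\<exists>h < 2 * m. org h = v \<and> ter h = u)" for v
      unfolding adj_sym[of u v] by (simp add: adj_def)
    show "org ` {h \<in> ins u. P h} = {v. adj u v \<and> Q v}"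
      unfolding nb using assms by (fastforce simp: image_iff)
  qed
qed

lemma in_degree: "v < n \<Longrightarrow> card (ins v) = k"
proof -
  assume v: "v < n"
  have "bij_betw rv (ins v) {e. e < 2 * m \<and> org e = v}"
    by (rule bij_betwI[of _ _ _ rv]) (auto simp: rv_less org_rv ter_rv rv_rv)
  then show ?thesis using out_degree[OF v] by (simp add: bij_betw_same_card)
qed

lemma sum_ins_of_bool:
  "(\<Sum>h \<in> ins u. of_bool (P h) :: real) = real (card {h \<in> ins u. P h})"
  by (simp add: of_bool_def sum.If_cases Int_def)

lemma walks2_refl: "u < n \<Longrightarrow> walks2 u u = k"
  using in_degree[of u] card_arcs_with_org[of "\<lambda>_. True" "\<lambda>_. True" u]
  by (simp add: walks2_def adj_sym[of _ u])

text \<open>A second midpoint between distinct ends would close a 4-cycle.\<close>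

lemma walks2_cases:
  assumes "u \<noteq> w"
  shows "walks2 u w = of_bool (\<exists>v. adj u v \<and> adj v w)"
proof (cases "\<exists>v. adj u v \<and> adj v w")
  case True
  then obtain v where v: "adj u v" "adj v w" by blast
  then have "{v. adj u v \<and> adj v w} = {v}" using adj_square assms by blast
  then show ?thesis using True by (simp add: walks2_def)
next
  case False
  then have "{v. adj u v \<and> adj v w} = {}" by blast
  then show ?thesis using False by (simp only: walks2_def card.empty of_bool_eq)
qed

lemma sum_ins_eq: "(\<Sum>h \<in> ins u. of_bool (org h = w) :: real) = of_bool (adj u w)"
proof -
  have "card {h \<in> ins u. org h = w} = card {v. adj u v \<and> v = w}"
    by (rule card_arcs_with_org) simp
  also have "{v. adj u v \<and> v = w} = (if adj u w then {w} else {})" by auto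
  finally show ?thesis by (simp add: sum_ins_of_bool)
qed

lemma sum_ins_adj: "(\<Sum>h \<in> ins u. of_bool (adj (org h) w) :: real) = real (walks2 u w)"
proof -
  have "card {h \<in> ins u. adj (org h) w} = card {v. adj u v \<and> adj v w}"
    by (rule card_arcs_with_org) simp
  then show ?thesis by (simp add: sum_ins_of_bool walks2_def)
qed

lemma sum_ins_single: "f < 2 * m \<Longrightarrow> (\<Sum>h \<in> ins u. of_bool (h = f) :: real) = of_bool (ter f = u)"
proof -
  assume f: "f < 2 * m"
  then have "{h \<in> ins u. h = f} = (if ter f = u then {f} else {})" by auto
  then show ?thesis by (simp add: sum_ins_of_bool)
qed

section \<open>Entries of the square and cube of the Grover matrix\<close>

definition grover :: "nat \<Rightarrow> nat \<Rightarrow> real" where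
  "grover e f = 2 / real k * of_bool (org e = ter f) - of_bool (e = rv f)"

text \<open>The action of \<open>a O T^T - J\<close> on a vector \<open>x\<close>, with
  \<open>a = 2/k\<close>: average over the arcs ending at the origin of \<open>e\<close>, then
  subtract the reversed value. Both powers are obtained by iterating it.\<close>

lemma grover_sum:
  assumes e: "e < 2 * m"
  shows "(\<Sum>h < 2 * m. grover e h * x h) = 2 / real k * (\<Sum>h \<in> ins (org e). x h) - x (rv e)"
proof -
  have "(\<Sum>h < 2 * m. grover e h * x h) =
      2 / real k * (\<Sum>h < 2 * m. of_bool (org e = ter h) * x h) - (\<Sum>h < 2 * m. of_bool (e = rv h) * x h)"
    unfolding grover_def left_diff_distrib sum_subtractf sum_distrib_left mult.assoc ..
  also have "(\<Sum>h < 2 * m. of_bool (org e = ter h) * x h) = (\<Sum>h \<in> ins (org e). x h)"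
    by (rule sum.mono_neutral_cong_right) auto
  also have "(\<Sum>h < 2 * m. of_bool (e = rv h) * x h) = (\<Sum>h \<in> {rv e}. x h)"
    using e by (intro sum.mono_neutral_cong_right) (auto simp: rv_less rv_rv)
  finally show ?thesis by simp
qed

definition grover2 :: "nat \<Rightarrow> nat \<Rightarrow> real" where
  "grover2 e f = (\<Sum>h < 2 * m. grover e h * grover h f)"

definition grover3 :: "nat \<Rightarrow> nat \<Rightarrow> real" where
  "grover3 e f = (\<Sum>h < 2 * m. grover e h * grover2 h f)"

text \<open>With \<open>T^T O = A\<close>, \<open>J O = T\<close> and \<open>J^2 = 1\<close>,
  squaring \<open>a O T^T - J\<close> gives
  \<open>a^2 O A T^T - a O O^T - a T T^T + 1\<close>.\<close>

lemma grover2_eq: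
  assumes e: "e < 2 * m" and f: "f < 2 * m"
  shows "grover2 e f = (2 / real k)\<^sup>2 * of_bool (adj (org e) (ter f))
    - 2 / real k * of_bool (org e = org f) - 2 / real k * of_bool (ter e = ter f) + of_bool (e = f)"
proof -
  have "(\<Sum>h \<in> ins (org e). grover h f) = (\<Sum>h \<in> ins (org e).
      2 / real k * of_bool (org h = ter f) - of_bool (h = rv f))"
    by (simp add: grover_def)
  also have "\<dots> = 2 / real k * of_bool (adj (org e) (ter f)) - of_bool (org e = org f)"
    unfolding sum_subtractf sum_distrib_left[symmetric] sum_ins_eq sum_ins_single[OF rv_less[OF f]]
    using f by (simp add: ter_rv eq_commute[of "org f" "org e"])
  finally have s: "(\<Sum>h \<in> ins (org e). grover h f) =
      2 / real k * of_bool (adj (org e) (ter f)) - of_bool (org e = org f)" .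
  have r: "grover (rv e) f = 2 / real k * of_bool (ter e = ter f) - of_bool (e = f)"
    using e f by (simp add: grover_def org_rv rv_eq_iff)
  show ?thesis
    unfolding grover2_def grover_sum[OF e] s r by (simp add: power2_eq_square algebra_simps)
qed

text \<open>Multiplying once more by \<open>a O T^T - J\<close> produces three multiples of
  \<open>O T^T\<close>, with coefficients \<open>a\<close>, \<open>a\<close> and
  \<open>- a^2 k\<close>. They cancel because \<open>a k = 2\<close>.\<close>

lemma grover3_eq:
  assumes e: "e < 2 * m" and f: "f < 2 * m"
  shows "grover3 e f = (2 / real k) ^ 3 * real (walks2 (org e) (ter f))
    - (2 / real k)\<^sup>2 * (of_bool (adj (org e) (org f)) + of_bool (adj (ter e) (ter f)))
    + 2 / real k * of_bool (ter e = org f) - of_bool (e = rv f)"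
proof -
  define a where "a = 2 / real k"
  have ak: "a * real k = 2" using degree_gt by (simp add: a_def)
  have "(\<Sum>h \<in> ins (org e). grover2 h f) = (\<Sum>h \<in> ins (org e). a\<^sup>2 * of_bool (adj (org h) (ter f))
    - a * of_bool (org h = org f) - a * of_bool (org e = ter f) + of_bool (h = f))"
    by (rule sum.cong) (use f in \<open>auto simp: grover2_eq a_def\<close>)
  also have "\<dots> = a\<^sup>2 * real (walks2 (org e) (ter f)) - a * of_bool (adj (org e) (org f))
      - a * real k * of_bool (org e = ter f) + of_bool (org e = ter f)"
    unfolding sum.distrib sum_subtractf sum_distrib_left[symmetric] sum_ins_eq
      sum_ins_single[OF f] sum_ins_adj
    using e by (simp add: in_degree org_less eq_commute[of "ter f" "org e"])
  finally have s: "(\<Sum>h \<in> ins (org e). grover2 h f) = a\<^sup>2 * real (walks2 (org e) (ter f))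
      - a * of_bool (adj (org e) (org f)) - of_bool (org e = ter f)"
    unfolding ak by simp
  have r: "grover2 (rv e) f = a\<^sup>2 * of_bool (adj (ter e) (ter f))
    - a * of_bool (ter e = org f) - a * of_bool (org e = ter f) + of_bool (e = rv f)"
    using e f rv_rv by (subst grover2_eq) (auto simp: rv_less ter_rv org_rv a_def)
  show ?thesis
    unfolding grover3_def grover_sum[OF e] s r a_def[symmetric]
    by (simp add: power3_eq_cube power2_eq_square algebra_simps)
qed

text \<open>The sign of an entry depends on whether \<open>e\<close> starts where \<open>f\<close>
  ends and on whether \<open>f\<close> starts where \<open>e\<close> ends, as
  \<open>0 < a < 1\<close>. The right-hand side is one expression, linear in the indicators and the
  walk count, that fits all cases, so that it can be read as a matrix identity.\<close>

lemma support_grover3: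
  assumes e: "e < 2 * m" and f: "f < 2 * m"
  shows "(if grover3 e f > 0 then 1 else 0) = real (walks2 (org e) (ter f))
    - of_bool (adj (org e) (org f)) - of_bool (adj (ter e) (ter f))
    - (real k - 2) * of_bool (org e = ter f) + 2 * of_bool (ter e = org f) - 2 * of_bool (e = rv f)"
proof -
  define a where "a = 2 / real k"
  have a: "0 < a" "a < 1" "a * real k = 2" using degree_gt by (auto simp: a_def)
  note g = grover3_eq[OF e f, folded a_def]
  have wr: "walks2 (ter f) (ter f) = k" using f by (simp add: walks2_refl ter_less)
  have rv_iff: "e = rv f \<longleftrightarrow> org e = ter f \<and> ter e = org f"
    using no_parallel[of e "rv f"] e f rv_less org_rv ter_rv by auto
  show ?thesis
  proof (cases "org e = ter f")
    case True
    \<comment> \<open>Here the walk term \<open>a^3 k\<close> cancels against the two adjacency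
      terms, both of which are present. What remains is 0 or \<open>a - 1\<close>, never
      positive.\<close>
    have "a ^ 3 * real k = 2 * a\<^sup>2" using a(3) by (simp add: power3_eq_cube power2_eq_square)
    then have "grover3 e f = (a - 1) * of_bool (ter e = org f)"
      using adj_arc[OF e] adj_arc[OF f] True
      by (simp add: g rv_iff wr algebra_simps)
    then have "\<not> grover3 e f > 0" using a by (auto simp: of_bool_def split: if_splits)
    then show ?thesis using adj_arc[OF e] adj_arc[OF f] True
      by (simp add: rv_iff wr algebra_simps)
  next
    case neq: False
    have w: "walks2 (org e) (ter f) = of_bool (\<exists>v. adj (org e) v \<and> adj v (ter f))"
      by (rule walks2_cases[OF neq])
    show ?thesis
    proof (cases "ter e = org f")
      case True
      have "adj (org e) (org f)" "adj (ter e) (ter f)" "\<exists>v. adj (org e) v \<and> adj v (ter f)"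
        using adj_arc(1)[OF e] adj_arc(1)[OF f] True by auto
      \<comment> \<open>Now \<open>f\<close> continues \<open>e\<close> without backtracking, so
        both adjacencies and a single 2-step walk occur.\<close>
      moreover have "a ^ 3 - 2 * a\<^sup>2 + a = a * (1 - a)\<^sup>2"
        by (simp add: power3_eq_cube power2_eq_square algebra_simps)
      moreover have "a * (1 - a)\<^sup>2 > 0" using a by simp
      ultimately show ?thesis by (simp add: g w rv_iff neq True)
    next
      case neq': False
      have "a ^ 3 - a\<^sup>2 = a\<^sup>2 * (a - 1)" by (simp add: power3_eq_cube power2_eq_square algebra_simps)
      moreover have "a\<^sup>2 * (a - 1) < 0" using a by (simp add: mult_pos_neg)
      ultimately have neg: "a ^ 3 - a\<^sup>2 < 0" by simp
      \<comment> \<open>Both adjacencies together would make \<open>org f\<close> and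
        \<open>ter e\<close> two different midpoints between \<open>org e\<close> and
        \<open>ter f\<close>.\<close>
      have one: "\<not> (adj (org e) (org f) \<and> adj (ter e) (ter f))"
        using adj_square[of "org e" "org f" "ter f" "ter e"] adj_arc(1)[OF e] adj_arc(1)[OF f] neq neq'
        by auto
      \<comment> \<open>Either adjacency extends, by \<open>f\<close> or by \<open>e\<close>, to a
        2-step walk, so the entry is \<open>a^3 - a^2 < 0\<close>. With neither, only the
        nonnegative walk term is left.\<close>
      have "\<exists>v. adj (org e) v \<and> adj v (ter f)" if "adj (org e) (org f) \<or> adj (ter e) (ter f)"
        using that adj_arc(1)[OF e] adj_arc(1)[OF f] by blast
      then show ?thesis using one neg a
        by (cases "adj (org e) (org f)"; cases "adj (ter e) (ter f)")
          (auto simp: g w rv_iff neq neq' of_bool_def)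
    qed
  qed
qed

text \<open>Counting arcs by origin gives \<open>2 m = n k\<close>. The bound makes the
  natural-number exponent \<open>m - n\<close> a true difference.\<close>

lemma order_le_size: "n \<le> m"
proof -
  have "2 * m = card (\<Union>v<n. {e. e < 2 * m \<and> org e = v})"
    by (subst card_lessThan[symmetric], rule arg_cong[where f = card]) (auto simp: org_less)
  also have "\<dots> = (\<Sum>v<n. card {e. e < 2 * m \<and> org e = v})"
    by (rule card_UN_disjoint) auto
  also have "\<dots> = n * k" by (simp add: out_degree)
  finally have "2 * m = n * k" .
  moreover have "n * 2 \<le> n * k" using degree_gt by (intro mult_le_mono) auto
  ultimately show ?thesis by linarith
qed

section \<open>The characteristic polynomial of the positive support\<close>

definition Org :: "complex mat" where
  "Org = mat (2 * m) n (\<lambda>(e, v). of_bool (org e = v))"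

definition Ter :: "complex mat" where
  "Ter = mat (2 * m) n (\<lambda>(e, v). of_bool (ter e = v))"

definition Rev :: "complex mat" where
  "Rev = mat (2 * m) (2 * m) (\<lambda>(e, f). of_bool (f = rv e))"

definition Adj :: "complex mat" where
  "Adj = mat n n (\<lambda>(u, v). of_bool (adj u v))"

definition Supp :: "complex mat" where
  "Supp = mat (2 * m) (2 * m) (\<lambda>(e, f). if grover3 e f > 0 then 1 else 0)"

lemma carriers [simp]:
  "Org \<in> carrier_mat (2 * m) n" "Ter \<in> carrier_mat (2 * m) n"
  "Rev \<in> carrier_mat (2 * m) (2 * m)" "Adj \<in> carrier_mat n n"
  "Supp \<in> carrier_mat (2 * m) (2 * m)"
  by (simp_all add: Org_def Ter_def Rev_def Adj_def Supp_def)

lemma dims [simp]: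
  "dim_row Org = 2 * m" "dim_col Org = n" "dim_row Ter = 2 * m" "dim_col Ter = n"
  "dim_row Rev = 2 * m" "dim_col Rev = 2 * m" "dim_row Adj = n" "dim_col Adj = n"
  "dim_row Supp = 2 * m" "dim_col Supp = 2 * m"
  by (simp_all add: Org_def Ter_def Rev_def Adj_def Supp_def)

lemma index_mats:
  "e < 2 * m \<Longrightarrow> v < n \<Longrightarrow> Org $$ (e, v) = of_bool (org e = v)"
  "e < 2 * m \<Longrightarrow> v < n \<Longrightarrow> Ter $$ (e, v) = of_bool (ter e = v)"
  "e < 2 * m \<Longrightarrow> f < 2 * m \<Longrightarrow> Rev $$ (e, f) = of_bool (f = rv e)"
  "u < n \<Longrightarrow> v < n \<Longrightarrow> Adj $$ (u, v) = of_bool (adj u v)"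
  by (simp_all add: Org_def Ter_def Rev_def Adj_def)

text \<open>Each row of an incidence matrix is a unit vector, so multiplication merely relabels
  rows.\<close>

lemma index_Org_mult:
  assumes "e < 2 * m" "dim_row X = n" "j < dim_col X"
  shows "(Org * X) $$ (e, j) = X $$ (org e, j)"
proof -
  have "(Org * X) $$ (e, j) = (\<Sum>v = 0..<n. of_bool (org e = v) * X $$ (v, j))"
    using assms by (simp add: Org_def scalar_prod_def)
  also have "\<dots> = (\<Sum>v \<in> {org e}. of_bool (org e = v) * X $$ (v, j))"
    using assms org_less by (intro sum.mono_neutral_right) auto
  finally show ?thesis by simp
qed

lemma index_Ter_mult:
  assumes "e < 2 * m" "dim_row X = n" "j < dim_col X"
  shows "(Ter * X) $$ (e, j) = X $$ (ter e, j)"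
proof -
  have "(Ter * X) $$ (e, j) = (\<Sum>v = 0..<n. of_bool (ter e = v) * X $$ (v, j))"
    using assms by (simp add: Ter_def scalar_prod_def)
  also have "\<dots> = (\<Sum>v \<in> {ter e}. of_bool (ter e = v) * X $$ (v, j))"
    using assms ter_less by (intro sum.mono_neutral_right) auto
  finally show ?thesis by simp
qed

lemma index_Rev_mult:
  assumes "e < 2 * m" "dim_row X = 2 * m" "j < dim_col X"
  shows "(Rev * X) $$ (e, j) = X $$ (rv e, j)"
proof -
  have "(Rev * X) $$ (e, j) = (\<Sum>f = 0..<2 * m. of_bool (f = rv e) * X $$ (f, j))"
    using assms by (simp add: Rev_def scalar_prod_def)
  also have "\<dots> = (\<Sum>f \<in> {rv e}. of_bool (f = rv e) * X $$ (f, j))"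
    using assms rv_less by (intro sum.mono_neutral_right) auto
  finally show ?thesis by simp
qed

text \<open>Turns the row selection by \<open>Org\<close> and \<open>Ter\<close> into column
  selection by their transposes.\<close>

lemma index_mult_transpose:
  fixes X Y :: "complex mat"
  assumes "i < dim_row X" "j < dim_row Y" "dim_col X = dim_col Y"
  shows "(X * transpose_mat Y) $$ (i, j) = (Y * transpose_mat X) $$ (j, i)"
  using assms by (simp add: scalar_prod_def mult.commute)

lemma index_mult_Org_transpose:
  assumes "i < dim_row X" "f < 2 * m" "dim_col X = n"
  shows "(X * transpose_mat Org) $$ (i, f) = X $$ (i, org f)"
  using index_mult_transpose[of i X f Org] index_Org_mult[of f "transpose_mat X" i] assms org_less
  by simp

lemma index_mult_Ter_transpose:
  assumes "i < dim_row X" "f < 2 * m" "dim_col X = n"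
  shows "(X * transpose_mat Ter) $$ (i, f) = X $$ (i, ter f)"
  using index_mult_transpose[of i X f Ter] index_Ter_mult[of f "transpose_mat X" i] assms ter_less
  by simp

text \<open>Reversal exchanges origin and terminus. This is the source of the intertwining relation
  for \<open>W = (O, T)\<close>.\<close>

lemma Rev_Org: "Rev * Org = Ter"
  by (rule eq_matI) (simp_all del: index_mult_mat(1) add: index_Rev_mult index_mats rv_less org_rv)

lemma Rev_Ter: "Rev * Ter = Org"
  by (rule eq_matI) (simp_all del: index_mult_mat(1) add: index_Rev_mult index_mats rv_less ter_rv)

lemma index_transpose_mult:
  assumes "i < n" "j < n"
  shows "(transpose_mat Org * Org) $$ (i, j) = of_nat (card {e. e < 2 * m \<and> org e = i \<and> org e = j})"
    and "(transpose_mat Ter * Ter) $$ (i, j) = of_nat (card {e. e < 2 * m \<and> ter e = i \<and> ter e = j})"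
    and "(transpose_mat Org * Ter) $$ (i, j) = of_nat (card {e. e < 2 * m \<and> org e = i \<and> ter e = j})"
    and "(transpose_mat Ter * Org) $$ (i, j) = of_nat (card {e. e < 2 * m \<and> ter e = i \<and> org e = j})"
proof -
  have *: "(\<Sum>e = 0..<2 * m. of_bool (P e) * of_bool (Q e)) = (of_nat (card {e. e < 2 * m \<and> P e \<and> Q e}) :: complex)"
    for P Q :: "nat \<Rightarrow> bool"
  proof -
    have "(\<Sum>e = 0..<2 * m. of_bool (P e) * of_bool (Q e) :: complex) = (\<Sum>e \<in> {e. e < 2 * m \<and> P e \<and> Q e}. 1)"
      by (rule sum.mono_neutral_cong_right) auto
    then show ?thesis by simp
  qed
  show "(transpose_mat Org * Org) $$ (i, j) = of_nat (card {e. e < 2 * m \<and> org e = i \<and> org e = j})"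
    "(transpose_mat Ter * Ter) $$ (i, j) = of_nat (card {e. e < 2 * m \<and> ter e = i \<and> ter e = j})"
    "(transpose_mat Org * Ter) $$ (i, j) = of_nat (card {e. e < 2 * m \<and> org e = i \<and> ter e = j})"
    "(transpose_mat Ter * Org) $$ (i, j) = of_nat (card {e. e < 2 * m \<and> ter e = i \<and> org e = j})"
    using assms by (simp_all add: Org_def Ter_def scalar_prod_def * del: of_bool_eq)
qed

lemma card_arcs_between:
  "card {e. e < 2 * m \<and> org e = u \<and> ter e = v} = of_bool (adj u v)"
proof (cases "adj u v")
  case True
  then obtain e where "e < 2 * m" "org e = u" "ter e = v" unfolding adj_def by blast
  then have "{e. e < 2 * m \<and> org e = u \<and> ter e = v} = {e}" using no_parallel by blast
  then show ?thesis using True by simp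
next
  case False
  then have "{e. e < 2 * m \<and> org e = u \<and> ter e = v} = {}" unfolding adj_def by blast
  then show ?thesis using False by (simp only: card.empty of_bool_eq)
qed

lemma transpose_Org_Org: "transpose_mat Org * Org = of_nat k \<cdot>\<^sub>m 1\<^sub>m n"
proof (rule eq_matI)
  fix i j assume "i < dim_row (of_nat k \<cdot>\<^sub>m 1\<^sub>m n :: complex mat)" "j < dim_col (of_nat k \<cdot>\<^sub>m 1\<^sub>m n :: complex mat)"
  then have ij: "i < n" "j < n" by auto
  have "{e. e < 2 * m \<and> org e = i \<and> org e = j} = (if i = j then {e. e < 2 * m \<and> org e = i} else {})"
    by auto
  then show "(transpose_mat Org * Org) $$ (i, j) = (of_nat k \<cdot>\<^sub>m 1\<^sub>m n) $$ (i, j)"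
    using ij by (simp del: index_mult_mat(1) add: index_transpose_mult out_degree)
qed auto

lemma transpose_Ter_Ter: "transpose_mat Ter * Ter = of_nat k \<cdot>\<^sub>m 1\<^sub>m n"
proof (rule eq_matI)
  fix i j assume "i < dim_row (of_nat k \<cdot>\<^sub>m 1\<^sub>m n :: complex mat)" "j < dim_col (of_nat k \<cdot>\<^sub>m 1\<^sub>m n :: complex mat)"
  then have ij: "i < n" "j < n" by auto
  have "{e. e < 2 * m \<and> ter e = i \<and> ter e = j} = (if i = j then ins i else {})"
    by auto
  then show "(transpose_mat Ter * Ter) $$ (i, j) = (of_nat k \<cdot>\<^sub>m 1\<^sub>m n) $$ (i, j)"
    using ij by (simp del: index_mult_mat(1) add: index_transpose_mult in_degree)
qed auto

lemma transpose_Org_Ter: "transpose_mat Org * Ter = Adj"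
  by (rule eq_matI) (auto simp del: index_mult_mat(1) simp: index_transpose_mult card_arcs_between Adj_def)

lemma transpose_Ter_Org: "transpose_mat Ter * Org = Adj"
  by (rule eq_matI)
    (auto simp del: index_mult_mat(1) simp: index_transpose_mult card_arcs_between conj_commute[of "ter _ = _"]
      adj_sym Adj_def)

lemma index_Adj_Adj: "u < n \<Longrightarrow> w < n \<Longrightarrow> (Adj * Adj) $$ (u, w) = of_nat (walks2 u w)"
proof -
  assume "u < n" "w < n"
  then have "(Adj * Adj) $$ (u, w) = (\<Sum>v = 0..<n. of_bool (adj u v) * of_bool (adj v w))"
    by (simp add: Adj_def scalar_prod_def)
  also have "\<dots> = (\<Sum>v \<in> {v. adj u v \<and> adj v w}. 1)"
    by (rule sum.mono_neutral_cong_right) (auto intro: adj_less)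
  finally show ?thesis by (simp add: walks2_def)
qed

section \<open>Low-rank form of the positive support\<close>

definition Z1 :: "complex mat" where
  "Z1 = Adj * Adj * transpose_mat Ter - Adj * transpose_mat Org - (of_nat k - 2) \<cdot>\<^sub>m transpose_mat Ter"

definition Z2 :: "complex mat" where
  "Z2 = 2 \<cdot>\<^sub>m transpose_mat Org - Adj * transpose_mat Ter"

lemma Z_carriers [simp]: "Z1 \<in> carrier_mat n (2 * m)" "Z2 \<in> carrier_mat n (2 * m)"
  unfolding Z1_def Z2_def by (auto intro!: minus_carrier_mat mult_carrier_mat[of _ n n])

text \<open>The terms of \<open>support_grover3\<close> are sorted by their left factor: those
  depending on \<open>e\<close> through its origin make up \<open>Z1\<close>, those through its
  terminus \<open>Z2\<close>. The full-rank term \<open>- 2 J\<close> stays apart.\<close>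

lemma Supp_decomp: "Supp = Org * Z1 + Ter * Z2 - 2 \<cdot>\<^sub>m Rev"
proof (rule eq_matI)
  fix e f assume "e < dim_row (Org * Z1 + Ter * Z2 - 2 \<cdot>\<^sub>m Rev)" "f < dim_col (Org * Z1 + Ter * Z2 - 2 \<cdot>\<^sub>m Rev)"
  then have e: "e < 2 * m" and f: "f < 2 * m" by auto
  have z1: "Z1 $$ (org e, f) = of_nat (walks2 (org e) (ter f)) - of_bool (adj (org e) (org f))
      - (of_nat k - 2) * of_bool (org e = ter f)"
    using e f org_less ter_less unfolding Z1_def
    by (simp del: index_mult_mat(1) add: index_mult_Org_transpose index_mult_Ter_transpose index_Adj_Adj
       index_mats eq_commute[of "ter f" "org e"])
  have z2: "Z2 $$ (ter e, f) = 2 * of_bool (ter e = org f) - of_bool (adj (ter e) (ter f))"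
    using e f org_less ter_less unfolding Z2_def
    by (simp del: index_mult_mat(1) add: index_mult_Org_transpose index_mult_Ter_transpose
       index_mats eq_commute[of "org f" "ter e"])
  have c: "dim_row Z1 = n" "dim_row Z2 = n" "dim_col Z1 = 2 * m" "dim_col Z2 = 2 * m"
    using Z_carriers by blast+
  have r: "e = rv f \<longleftrightarrow> f = rv e" using e f rv_rv by metis
  have "Supp $$ (e, f) = of_real (if grover3 e f > 0 then 1 else 0)"
    using e f by (simp add: Supp_def)
  also have "\<dots> = (Org * Z1 + Ter * Z2 - 2 \<cdot>\<^sub>m Rev) $$ (e, f)"
    unfolding support_grover3[OF e f]
    using e f c by (simp del: index_mult_mat(1) add: index_Org_mult index_Ter_mult z1 z2 Rev_def r)
  finally show "Supp $$ (e, f) = (Org * Z1 + Ter * Z2 - 2 \<cdot>\<^sub>m Rev) $$ (e, f)" .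
qed (use carriers Z_carriers in auto)

text \<open>Since \<open>O^T O = T^T T = k\<close> and \<open>O^T T = T^T O = A\<close>, all blocks
  of \<open>Z W\<close> are polynomials in \<open>A\<close>; hence they commute and share one
  triangularisation.\<close>

lemma Z1_Org: "Z1 * Org = Adj * Adj * Adj - of_nat k \<cdot>\<^sub>m Adj - (of_nat k - 2) \<cdot>\<^sub>m Adj"
  and Z1_Ter: "Z1 * Ter = of_nat k \<cdot>\<^sub>m (Adj * Adj) - Adj * Adj - ((of_nat k - 2) * of_nat k) \<cdot>\<^sub>m 1\<^sub>m n"
  and Z2_Org: "Z2 * Org = (2 * of_nat k) \<cdot>\<^sub>m 1\<^sub>m n - Adj * Adj"
  and Z2_Ter: "Z2 * Ter = 2 \<cdot>\<^sub>m Adj - of_nat k \<cdot>\<^sub>m Adj"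
proof -
  have s: "c \<cdot>\<^sub>m (d \<cdot>\<^sub>m X) = (c * d) \<cdot>\<^sub>m X" for c d :: complex and X
    by (intro eq_matI) auto
  note [simp] = minus_carrier_mat mult_carrier_mat[of _ n n _ "2 * m"] mult_carrier_mat[of _ n n _ n]
    minus_mult_distrib_mat[of _ n "2 * m" _ _ n] mult_smult_assoc_mat[of _ n "2 * m" _ n]
    mult_smult_distrib[of _ n n _ n] assoc_mult_mat[of _ n n _ "2 * m" _ n]
    transpose_Org_Org transpose_Ter_Ter transpose_Org_Ter transpose_Ter_Org s
  show "Z1 * Org = Adj * Adj * Adj - of_nat k \<cdot>\<^sub>m Adj - (of_nat k - 2) \<cdot>\<^sub>m Adj"
    unfolding Z1_def by simp
  show "Z1 * Ter = of_nat k \<cdot>\<^sub>m (Adj * Adj) - Adj * Adj - ((of_nat k - 2) * of_nat k) \<cdot>\<^sub>m 1\<^sub>m n"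
    unfolding Z1_def by simp
  show "Z2 * Org = (2 * of_nat k) \<cdot>\<^sub>m 1\<^sub>m n - Adj * Adj"
    unfolding Z2_def by simp
  show "Z2 * Ter = 2 \<cdot>\<^sub>m Adj - of_nat k \<cdot>\<^sub>m Adj"
    unfolding Z2_def by simp
qed

text \<open>
  These are the blocks of \<open>Y - ZW\<close> with \<open>Y\<close> = \<open>x + 2\<sigma>\<close>, where \<open>\<sigma>\<close> exchanges the
  two blocks of \<open>W\<close> just as \<open>Rev\<close> exchanges \<open>Org\<close> and \<open>Ter\<close>.
\<close>
definition N11 :: "complex \<Rightarrow> complex mat" where
  "N11 x = x \<cdot>\<^sub>m 1\<^sub>m n - Z1 * Org"
definition N12 :: "complex mat" where
  "N12 = 2 \<cdot>\<^sub>m 1\<^sub>m n - Z1 * Ter"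
definition N21 :: "complex mat" where
  "N21 = 2 \<cdot>\<^sub>m 1\<^sub>m n - Z2 * Org"
definition N22 :: "complex \<Rightarrow> complex mat" where
  "N22 x = x \<cdot>\<^sub>m 1\<^sub>m n - Z2 * Ter"

lemma N_carriers [simp]:
  "N11 x \<in> carrier_mat n n" "N12 \<in> carrier_mat n n" "N21 \<in> carrier_mat n n" "N22 x \<in> carrier_mat n n"
  unfolding N11_def N12_def N21_def N22_def
  by (auto intro!: minus_carrier_mat mult_carrier_mat[of _ n "2 * m"])

text \<open>\<open>det_update_intertwined\<close> with \<open>X = x + 2 J\<close>. The powers of
  \<open>x^2 - 4\<close> are \<open>det X\<close> and \<open>det Y\<close>; as they can vanish at 2
  and -2, they are kept as factors until polynomials are compared.\<close>

lemma det_Supp: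
  "det (x \<cdot>\<^sub>m 1\<^sub>m (2 * m) - Supp) * (x\<^sup>2 - 4) ^ n =
     (x\<^sup>2 - 4) ^ m * det (four_block_mat (N11 x) N12 N21 (N22 x))"
proof -
  let ?X = "x \<cdot>\<^sub>m 1\<^sub>m (2 * m) + 2 \<cdot>\<^sub>m Rev"
  \<comment> \<open>Empty blocks turn the juxtaposition of \<open>O\<close> beside \<open>T\<close>,
    and of \<open>Z1\<close> above \<open>Z2\<close>, into four-block matrices, so that block
    multiplication applies.\<close>
  define W where "W = four_block_mat Org Ter (0\<^sub>m 0 n) (0\<^sub>m 0 n)"
  define Z where "Z = four_block_mat Z1 (0\<^sub>m n 0) Z2 (0\<^sub>m n 0)"
  let ?I = "1\<^sub>m n :: complex mat"
  define Y where "Y = four_block_mat (x \<cdot>\<^sub>m ?I) (2 \<cdot>\<^sub>m ?I) (2 \<cdot>\<^sub>m ?I) (x \<cdot>\<^sub>m ?I)"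
  have four0: "four_block_mat M (0\<^sub>m (2 * m) 0) (0\<^sub>m 0 (2 * m)) (0\<^sub>m 0 0) = M"
    if "M \<in> carrier_mat (2 * m) (2 * m)" for M :: "complex mat"
    using that by (intro eq_matI) auto
  have X: "?X \<in> carrier_mat (2 * m) (2 * m)" by simp
  have W: "W \<in> carrier_mat (2 * m) (n + n)"
    unfolding W_def using four_block_carrier_mat[of Org "2 * m" n "0\<^sub>m 0 n" 0 n] by simp
  have Z: "Z \<in> carrier_mat (n + n) (2 * m)"
    unfolding Z_def using four_block_carrier_mat[of Z1 n "2 * m" "0\<^sub>m n 0" n 0] by simp
  have Y: "Y \<in> carrier_mat (n + n) (n + n)"
    unfolding Y_def by (rule four_block_carrier_mat) auto
  have WZ: "W * Z = Org * Z1 + Ter * Z2"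
  proof -
    have c: "Org * Z1 + Ter * Z2 \<in> carrier_mat (2 * m) (2 * m)"
      by (intro add_carrier_mat mult_carrier_mat[of _ _ n]) simp_all
    have "W * Z = four_block_mat (Org * Z1 + Ter * Z2) (Org * 0\<^sub>m n 0 + Ter * 0\<^sub>m n 0)
        (0\<^sub>m 0 n * Z1 + 0\<^sub>m 0 n * Z2) (0\<^sub>m 0 n * 0\<^sub>m n 0 + 0\<^sub>m 0 n * 0\<^sub>m n 0)"
      unfolding W_def Z_def
      by (rule mult_four_block_mat[OF _ _ _ _ Z_carriers(1) _ Z_carriers(2)]) auto
    also have "\<dots> = Org * Z1 + Ter * Z2"
      by (rule trans[OF _ four0[OF c]], rule cong_four_block_mat)
        (auto simp: left_mult_zero_mat[of _ n "2 * m"])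
    finally show ?thesis .
  qed
  have XW: "?X * W = W * Y"
  proof -
    have XO: "?X * Org = x \<cdot>\<^sub>m Org + 2 \<cdot>\<^sub>m Ter" "?X * Ter = x \<cdot>\<^sub>m Ter + 2 \<cdot>\<^sub>m Org"
      by (subst add_mult_distrib_mat[of _ "2 * m" "2 * m" _ _ n];
        simp add: mult_smult_assoc_mat[of _ "2 * m" "2 * m" _ n] Rev_Org Rev_Ter)+
    have "?X * W = four_block_mat ?X (0\<^sub>m (2 * m) 0) (0\<^sub>m 0 (2 * m)) (0\<^sub>m 0 0) * W"
      by (simp add: four0)
    also have "\<dots> = four_block_mat (?X * Org + 0\<^sub>m (2 * m) 0 * 0\<^sub>m 0 n) (?X * Ter + 0\<^sub>m (2 * m) 0 * 0\<^sub>m 0 n)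
        (0\<^sub>m 0 (2 * m) * Org + 0\<^sub>m 0 0 * 0\<^sub>m 0 n) (0\<^sub>m 0 (2 * m) * Ter + 0\<^sub>m 0 0 * 0\<^sub>m 0 n)"
      unfolding W_def by (rule mult_four_block_mat) auto
    also have "\<dots> = four_block_mat (x \<cdot>\<^sub>m Org + 2 \<cdot>\<^sub>m Ter) (x \<cdot>\<^sub>m Ter + 2 \<cdot>\<^sub>m Org) (0\<^sub>m 0 n) (0\<^sub>m 0 n)"
      unfolding XO by (rule cong_four_block_mat) (auto intro!: eq_matI simp: scalar_prod_def)
    also have "\<dots> = four_block_mat (Org * (x \<cdot>\<^sub>m ?I) + Ter * (2 \<cdot>\<^sub>m ?I)) (Org * (2 \<cdot>\<^sub>m ?I) + Ter * (x \<cdot>\<^sub>m ?I))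
        (0\<^sub>m 0 n * (x \<cdot>\<^sub>m ?I) + 0\<^sub>m 0 n * (2 \<cdot>\<^sub>m ?I)) (0\<^sub>m 0 n * (2 \<cdot>\<^sub>m ?I) + 0\<^sub>m 0 n * (x \<cdot>\<^sub>m ?I))"
    proof (rule cong_four_block_mat)
      have "Org * (c \<cdot>\<^sub>m ?I) = c \<cdot>\<^sub>m Org" "Ter * (c \<cdot>\<^sub>m ?I) = c \<cdot>\<^sub>m Ter" for c
        by (simp_all add: mult_smult_distrib[of _ "2 * m" n _ n])
      then show "x \<cdot>\<^sub>m Org + 2 \<cdot>\<^sub>m Ter = Org * (x \<cdot>\<^sub>m ?I) + Ter * (2 \<cdot>\<^sub>m ?I)"
        "x \<cdot>\<^sub>m Ter + 2 \<cdot>\<^sub>m Org = Org * (2 \<cdot>\<^sub>m ?I) + Ter * (x \<cdot>\<^sub>m ?I)"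
        by (simp_all add: comm_add_mat[of _ "2 * m" n])
    qed (auto intro!: eq_matI)
    also have "\<dots> = W * Y"
      unfolding W_def Y_def by (rule mult_four_block_mat[symmetric]) auto
    finally show ?thesis .
  qed
  have YZW: "Y - Z * W = four_block_mat (N11 x) N12 N21 (N22 x)"
  proof -
    have "Z * W = four_block_mat (Z1 * Org + 0\<^sub>m n 0 * 0\<^sub>m 0 n) (Z1 * Ter + 0\<^sub>m n 0 * 0\<^sub>m 0 n)
        (Z2 * Org + 0\<^sub>m n 0 * 0\<^sub>m 0 n) (Z2 * Ter + 0\<^sub>m n 0 * 0\<^sub>m 0 n)"
      unfolding W_def Z_def
      by (rule mult_four_block_mat[OF Z_carriers(1) _ Z_carriers(2)]) auto
    also have "\<dots> = four_block_mat (Z1 * Org) (Z1 * Ter) (Z2 * Org) (Z2 * Ter)"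
      by (rule cong_four_block_mat)
        (simp_all add: right_add_zero_mat[of _ n n] mult_carrier_mat[of _ n "2 * m"])
    finally have "Z * W = four_block_mat (Z1 * Org) (Z1 * Ter) (Z2 * Org) (Z2 * Ter)" .
    then show ?thesis
      unfolding Y_def N11_def N12_def N21_def N22_def
      by (simp only:) (rule minus_four_block_mat[of _ n n _ n _ n]; auto intro!: mult_carrier_mat[of _ n "2 * m"])
  qed
  have XWZ: "?X - W * Z = x \<cdot>\<^sub>m 1\<^sub>m (2 * m) - Supp"
  proof -
    have c: "Org * Z1 + Ter * Z2 \<in> carrier_mat (2 * m) (2 * m)"
      by (intro add_carrier_mat mult_carrier_mat[of _ _ n]) simp_all
    show ?thesis
      unfolding WZ Supp_decomp using c by (intro eq_matI) auto
  qed
  have detX: "det ?X = (x\<^sup>2 - 4) ^ m"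
    using det_fixpoint_free_involution[of m rv x 2] rv_less rv_rv rv_neq by (simp add: Rev_def)
  \<comment> \<open>The blocks of \<open>Y\<close> are scalar matrices and commute, so the block
    determinant reduces to size \<open>n\<close>.\<close>
  have "det Y = det (x \<cdot>\<^sub>m ?I * (x \<cdot>\<^sub>m ?I) - 2 \<cdot>\<^sub>m ?I * (2 \<cdot>\<^sub>m ?I))"
    unfolding Y_def
    by (rule det_four_block_mat)
      (auto simp: mult_smult_distrib[of _ n n _ n] mult_smult_assoc_mat[of _ n n _ n] mult.commute)
  also have "x \<cdot>\<^sub>m ?I * (x \<cdot>\<^sub>m ?I) - 2 \<cdot>\<^sub>m ?I * (2 \<cdot>\<^sub>m ?I) = (x\<^sup>2 - 4) \<cdot>\<^sub>m ?I"
    by (simp add: mult_smult_distrib[of _ n n _ n] mult_smult_assoc_mat[of _ n n _ n], intro eq_matI)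
      (auto simp: power2_eq_square)
  finally have detY: "det Y = (x\<^sup>2 - 4) ^ n" by (simp add: det_smult)
  show ?thesis
    using det_update_intertwined[OF X W Z Y XW] unfolding XWZ YZW detX detY .
qed

text \<open>The lower blocks commute, so the determinant is that of
  \<open>N11 * N22 - N12 * N21\<close>, a polynomial in \<open>A\<close>. A Schur triangularisation
  of \<open>A\<close> puts its value at each eigenvalue on the diagonal.\<close>

lemma det_N:
  assumes as: "char_poly Adj = (\<Prod>a\<leftarrow>as. [:- a, 1:])" and len: "length as = n"
  shows "det (four_block_mat (N11 x) N12 N21 (N22 x)) = (\<Prod>a\<leftarrow>as. x\<^sup>2
    - a * (a\<^sup>2 - 3 * of_nat k + 4) * x
    + (a\<^sup>2 - 2 * (of_nat k - 1)) * (a\<^sup>2 - of_nat k ^ 2 + 2 * of_nat k - 2))"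
proof -
  obtain B P Q where "schur_decomposition Adj as = (B, P, Q)" by (cases "schur_decomposition Adj as")
  from schur_decomposition[OF carriers(4) as this]
  have sim: "similar_mat_wit Adj B P Q" and ut: "upper_triangular B" and diag: "diag_mat B = as"
    by auto
  from similar_mat_witD2[OF carriers(4) sim]
  have P: "P \<in> carrier_mat n n" and Q: "Q \<in> carrier_mat n n" and B: "B \<in> carrier_mat n n"
    and PQ: "P * Q = 1\<^sub>m n" and QP: "Q * P = 1\<^sub>m n" and A: "Adj = P * B * Q" by auto
  interpret similarity n P Q by unfold_locales (fact P Q PQ QP)+
  have "Q * Adj * P = Q * P * B * (Q * P)"
    unfolding A using P Q B by (simp add: assoc_mult_mat[of _ n n _ n _ n])
  also have "\<dots> = B" using B by (simp add: QP)
  finally have triA: "tri Adj (\<lambda>i. as ! i)"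
    using ut B diag by (auto simp: tri_def diag_mat_def)
  note tri_intros = tri_minus tri_mult tri_smult tri_one triA
  note [simp] = minus_carrier_mat mult_carrier_mat[of _ n n _ n]
    minus_mult_distrib_mat[of _ n n _ _ n] mult_minus_distrib_mat[of _ n n _ n]
    mult_smult_assoc_mat[of _ n n _ n] mult_smult_distrib[of _ n n _ n]
  \<comment> \<open>Commuting with \<open>Adj\<close> is enough, because \<open>N22 x\<close> is
    affine in \<open>Adj\<close>.\<close>
  have "N21 * Adj = Adj * N21"
    unfolding N21_def Z2_Org by (simp add: assoc_mult_mat[of _ n n _ n _ n])
  then have "N21 * N22 x = N22 x * N21"
    unfolding N22_def Z2_Ter
    by (simp add: right_mult_one_mat[of N21 n n] left_mult_one_mat[of N21 n n])
  then have "det (four_block_mat (N11 x) N12 N21 (N22 x)) = det (N11 x * N22 x - N12 * N21)"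
    by (intro det_four_block_mat[of _ n]) auto
  \<comment> \<open>The closure rules of \<open>tri\<close> compute the diagonal from the shape of
    the term. The constant coefficient factors because \<open>a^2 - 2(k-1)\<close>, the value of
    \<open>N21\<close>, also divides the value of \<open>Z1 * Org\<close>.\<close>
  also have "\<dots> = (\<Prod>i<n. (\<lambda>a. x\<^sup>2 - a * (a\<^sup>2 - 3 * of_nat k + 4) * x
    + (a\<^sup>2 - 2 * (of_nat k - 1)) * (a\<^sup>2 - of_nat k ^ 2 + 2 * of_nat k - 2)) (as ! i))"
    unfolding N11_def N12_def N21_def N22_def Z1_Org Z1_Ter Z2_Org Z2_Ter
    by (rule trans[OF det_tri], (rule tri_intros)+, rule prod.cong)
      (auto simp: power2_eq_square algebra_simps)
  also have "\<dots> = (\<Prod>a\<leftarrow>as. x\<^sup>2 - a * (a\<^sup>2 - 3 * of_nat k + 4) * x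
    + (a\<^sup>2 - 2 * (of_nat k - 1)) * (a\<^sup>2 - of_nat k ^ 2 + 2 * of_nat k - 2))"
    by (simp add: prod.list_conv_set_nth len atLeast0LessThan)
  finally show ?thesis .
qed

text \<open>As polynomials, both sides of \<open>det_Supp\<close> contain the nonzero factor
  \<open>(x^2 - 4)^n\<close>, which can be cancelled because \<open>n \<le> m\<close>.\<close>

lemma char_poly_Supp:
  assumes as: "char_poly Adj = (\<Prod>a\<leftarrow>as. [:- a, 1:])" and len: "length as = n"
  shows "char_poly Supp = [:- 4, 0, 1:] ^ (m - n) *
    (\<Prod>a\<leftarrow>as. [:(a\<^sup>2 - 2 * (of_nat k - 1)) * (a\<^sup>2 - of_nat k ^ 2 + 2 * of_nat k - 2),
      - (a * (a\<^sup>2 - 3 * of_nat k + 4)), 1:])" (is "_ = _ * ?p")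
proof -
  have "char_poly Supp * [:- 4, 0, 1:] ^ n = [:- 4, 0, 1:] ^ m * ?p"
  proof (rule poly_ext)
    fix x :: complex
    have "poly [:- 4, 0, 1:] x = x\<^sup>2 - 4" by (simp add: power2_eq_square)
    moreover have "poly ?p x = det (four_block_mat (N11 x) N12 N21 (N22 x))"
      unfolding det_N[OF as len] poly_prod_list map_map o_def
      by (rule arg_cong[where f = prod_list], rule map_cong) (auto simp: power2_eq_square algebra_simps)
    ultimately show "poly (char_poly Supp * [:- 4, 0, 1:] ^ n) x = poly ([:- 4, 0, 1:] ^ m * ?p) x"
      by (simp only: poly_mult poly_power poly_char_poly[OF carriers(5)] det_Supp)
  qed
  also have "[:- 4, 0, 1:] ^ m = [:- 4, 0, 1 :: complex:] ^ (m - n) * [:- 4, 0, 1:] ^ n"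
    using order_le_size by (simp add: power_add[symmetric])
  finally have "(char_poly Supp - [:- 4, 0, 1:] ^ (m - n) * ?p) * [:- 4, 0, 1:] ^ n = 0"
    by (simp add: algebra_simps)
  then show ?thesis by simp
qed

end

section \<open>Enumerated digraphs\<close>

locale enumerated_graph = bidirected_digraph G arev
  for G :: "('a, 'b) pre_digraph" and arev +
  fixes vs :: "'a list" and es :: "'b list" and k n m :: nat
  assumes regular: "k_regular G arev k" and k_gt: "k > 2"
    and girth_gt: "girth G arev > 4"
    and n_eq: "n = card (verts G)" and m_eq: "m = card (uedges G arev)"
    and dist_vs: "distinct vs" and set_vs: "set vs = verts G"
    and dist_es: "distinct es" and set_es: "set es = arcs G"
begin

section \<open>Consequences of the girth bound\<close>

lemma length_essential_cycle:
  assumes "essential_cycle G arev p"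
  shows "length p > 4"
proof -
  have "girth G arev \<le> enat (length p)"
    unfolding girth_def using assms by (intro INF_lower) simp
  with girth_gt have "4 < enat (length p)" by (rule less_le_trans)
  then show ?thesis by (metis enat_ord_simps(2) numeral_eq_enat)
qed

lemma loopless:
  assumes e: "e \<in> arcs G"
  shows "tail G e \<noteq> head G e"
proof
  assume l: "tail G e = head G e"
  \<comment> \<open>A loop run through twice in the same direction does not backtrack, as
    \<open>arev e\<close> differs from \<open>e\<close>.\<close>
  have "essential_cycle G arev [e, e]"
    unfolding essential_cycle_def reduced_def
    using e l arev_neq[OF e] by (intro exI[of _ "tail G e"]) (auto simp: awalk_def)
  then show False using length_essential_cycle by fastforce
qed

lemma no_parallel_arcs:
  assumes e: "e \<in> arcs G" "f \<in> arcs G" and "tail G e = tail G f" "head G e = head G f"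
  shows "e = f"
proof (rule ccontr)
  assume "e \<noteq> f"
  then have "essential_cycle G arev [e, arev f]"
    unfolding essential_cycle_def reduced_def
    using assms by (intro exI[of _ "tail G e"]) (auto simp: awalk_def)
  then show False using length_essential_cycle by fastforce
qed

text \<open>The walk \<open>a\<close>, \<open>b\<close> followed by the reverse of \<open>c\<close>,
  \<open>d\<close> is closed. Distinct ends and distinct midpoints make it reduced, so it would be
  an essential cycle of length 4.\<close>

lemma no_square_arcs:
  assumes arcs: "a \<in> arcs G" "b \<in> arcs G" "c \<in> arcs G" "d \<in> arcs G"
    and ends: "head G a = tail G b" "head G c = tail G d" "tail G a = tail G c" "head G b = head G d"
    and neq: "tail G a \<noteq> head G b"
  shows "head G a = head G c"
proof (rule ccontr)
  assume h: "head G a \<noteq> head G c"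
  have "arev b \<noteq> a" using arcs neq head_arev[of b] tail_arev[of b] by auto
  moreover have "d \<noteq> b" using h ends by auto
  moreover have "c \<noteq> arev d" using arcs neq ends tail_arev[of d] by auto
  ultimately have "reduced arev [a, b, arev d, arev c]"
    by (auto simp: reduced_def less_Suc_eq nth_Cons split: nat.splits)
  moreover have "awalk (tail G a) [a, b, arev d, arev c] (tail G a)"
    using arcs ends by (auto simp: awalk_def)
  \<comment> \<open>The vertices concerned are the heads of \<open>a\<close>, \<open>b\<close> and
    \<open>c\<close>. Looplessness of \<open>b\<close> and \<open>d\<close> separates the middle one
    from its neighbours.\<close>
  moreover have "distinct (butlast (tl (awalk_verts (tail G a) [a, b, arev d, arev c])))"
    using arcs ends h loopless[of b] loopless[of d] by auto
  ultimately have "essential_cycle G arev [a, b, arev d, arev c]"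
    unfolding essential_cycle_def by (intro exI[of _ "tail G a"]) auto
  then show False using length_essential_cycle by fastforce
qed

text \<open>The degree counts unoriented edges; without loops, each edge at \<open>v\<close> has
  exactly one orientation leaving \<open>v\<close>.\<close>

lemma card_out_arcs:
  assumes v: "v \<in> verts G"
  shows "card {e \<in> arcs G. tail G e = v} = k"
proof -
  have "bij_betw (\<lambda>e. {e, arev e}) {e \<in> arcs G. tail G e = v}
      {x \<in> uedges G arev. \<exists>e\<in>x. tail G e = v \<or> head G e = v}"
    unfolding bij_betw_def
  proof
    show "inj_on (\<lambda>e. {e, arev e}) {e \<in> arcs G. tail G e = v}"
    proof (rule inj_onI)
      fix e f
      assume ef: "e \<in> {e \<in> arcs G. tail G e = v}" "f \<in> {e \<in> arcs G. tail G e = v}"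
        and "{e, arev e} = {f, arev f}"
      then have "e = f \<or> e = arev f" by blast
      then show "e = f" using ef loopless[of f] by auto
    qed
    show "(\<lambda>e. {e, arev e}) ` {e \<in> arcs G. tail G e = v} =
        {x \<in> uedges G arev. \<exists>e\<in>x. tail G e = v \<or> head G e = v}"
    proof (intro equalityI subsetI)
      fix x assume "x \<in> {x \<in> uedges G arev. \<exists>e\<in>x. tail G e = v \<or> head G e = v}"
      then obtain e where e: "e \<in> arcs G" "x = {e, arev e}" "tail G e = v \<or> head G e = v"
        by (auto simp: uedges_def)
      show "x \<in> (\<lambda>e. {e, arev e}) ` {e \<in> arcs G. tail G e = v}"
      proof (cases "tail G e = v")
        case True
        then show ?thesis using e by (intro image_eqI[of _ _ e]) simp_all
      next
        case False
        then show ?thesis using e by (intro image_eqI[of _ _ "arev e"]) (simp_all add: insert_commute)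
      qed
    qed (auto simp: uedges_def)
  qed
  then have "card {e \<in> arcs G. tail G e = v} = deg G arev v"
    unfolding deg_def by (rule bij_betw_same_card)
  then show ?thesis using regular v by (simp add: k_regular_def)
qed

section \<open>Passage from the digraph to matrix indices\<close>

lemma length_vs: "length vs = n"
  using distinct_card[OF dist_vs] by (simp add: set_vs n_eq)

text \<open>The orbits of the fixed-point free reversal partition the arcs into pairs.\<close>

lemma length_es: "length es = 2 * m"
proof -
  have fa: "finite (arcs G)" using set_es by (metis List.finite_set)
  have U: "\<Union> (uedges G arev) = arcs G" by (auto simp: uedges_def)
  have "2 * card (uedges G arev) = card (\<Union> (uedges G arev))"
  proof (rule card_partition)
    show "finite (uedges G arev)" "finite (\<Union> (uedges G arev))"
      unfolding U using fa by (simp_all add: uedges_def)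
    show "card x = 2" if "x \<in> uedges G arev" for x
      using that arev_neq by (fastforce simp: uedges_def card_insert_if)
    fix x y assume xy: "x \<in> uedges G arev" "y \<in> uedges G arev" "x \<noteq> y"
    then obtain e f where "x = {e, arev e}" "y = {f, arev f}" by (auto simp: uedges_def)
    then show "x \<inter> y = {}" using xy(3) arev_arev by (metis disjoint_insert(2) doubleton_eq_iff
      inf_bot_right insert_disjoint(1) insert_iff singletonD)
  qed
  then show ?thesis using distinct_card[OF dist_es] by (simp add: U set_es m_eq)
qed

definition vpos :: "'a \<Rightarrow> nat" where "vpos = inv_into {..<n} ((!) vs)"
definition epos :: "'b \<Rightarrow> nat" where "epos = inv_into {..<2 * m} ((!) es)"

lemma vpos: "v \<in> verts G \<Longrightarrow> vpos v < n \<and> vs ! vpos v = v"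
proof -
  assume "v \<in> verts G"
  then have "v \<in> (!) vs ` {..<n}" by (auto simp: set_vs[symmetric] length_vs[symmetric] in_set_conv_nth)
  then show ?thesis
    unfolding vpos_def using inv_into_into[of v "(!) vs" "{..<n}"] f_inv_into_f[of v "(!) vs" "{..<n}"]
    by auto
qed

lemma epos: "e \<in> arcs G \<Longrightarrow> epos e < 2 * m \<and> es ! epos e = e"
proof -
  assume "e \<in> arcs G"
  then have "e \<in> (!) es ` {..<2 * m}" by (auto simp: set_es[symmetric] length_es[symmetric] in_set_conv_nth)
  then show ?thesis
    unfolding epos_def using inv_into_into[of e "(!) es" "{..<2 * m}"] f_inv_into_f[of e "(!) es" "{..<2 * m}"]
    by auto
qed

lemma nth_arc: "i < 2 * m \<Longrightarrow> es ! i \<in> arcs G"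
  using length_es set_es nth_mem[of i es] by simp

lemma nth_vert: "i < n \<Longrightarrow> vs ! i \<in> verts G"
  using length_vs set_vs nth_mem[of i vs] by simp

lemma epos_nth: "i < 2 * m \<Longrightarrow> epos (es ! i) = i"
  using epos[OF nth_arc] dist_es length_es by (metis nth_eq_iff_index_eq)

lemma vpos_nth: "i < n \<Longrightarrow> vpos (vs ! i) = i"
  using vpos[OF nth_vert] dist_vs length_vs by (metis nth_eq_iff_index_eq)

lemma vpos_eq_iff: "u \<in> verts G \<Longrightarrow> v \<in> verts G \<Longrightarrow> vpos u = vpos v \<longleftrightarrow> u = v"
  by (metis vpos)

abbreviation "ix_org i \<equiv> vpos (tail G (es ! i))"
abbreviation "ix_ter i \<equiv> vpos (head G (es ! i))"
abbreviation "ix_rv i \<equiv> epos (arev (es ! i))"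

lemma bij_nth_es: "bij_betw ((!) es) {i. i < 2 * m \<and> P (es ! i)} {e \<in> arcs G. P e}"
  by (rule bij_betwI[of _ _ _ epos]) (auto simp: nth_arc epos epos_nth)

lemma card_nth_es: "card {i. i < 2 * m \<and> P (es ! i)} = card {e \<in> arcs G. P e}"
  using bij_nth_es by (rule bij_betw_same_card)

sublocale ix: indexed_graph m n k ix_org ix_ter ix_rv
proof
  fix v assume v: "v < n"
  have "{e. e < 2 * m \<and> ix_org e = v} = {e. e < 2 * m \<and> tail G (es ! e) = vs ! v}"
    using v vpos vpos_nth nth_arc by (auto dest: tail_in_verts)
  then show "card {e. e < 2 * m \<and> ix_org e = v} = k"
    using card_nth_es[of "\<lambda>e. tail G e = vs ! v"] card_out_arcs[OF nth_vert[OF v]] by simp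
next
  show "k > 2" by (rule k_gt)
next
  fix e f assume "e < 2 * m" "f < 2 * m" "ix_org e = ix_org f" "ix_ter e = ix_ter f"
  then show "e = f"
    using no_parallel_arcs[of "es ! e" "es ! f"] nth_arc epos_nth by (metis vpos_eq_iff wellformed)
next
  fix a b c d
  assume "a < 2 * m" "b < 2 * m" "c < 2 * m" "d < 2 * m" "ix_ter a = ix_org b" "ix_ter c = ix_org d"
    "ix_org a = ix_org c" "ix_ter b = ix_ter d" "ix_org a \<noteq> ix_ter b"
  then show "ix_ter a = ix_ter c"
    using no_square_arcs[of "es ! a" "es ! b" "es ! c" "es ! d"] nth_arc
    by (simp add: vpos_eq_iff)
qed (use nth_arc vpos epos epos_nth loopless in \<open>auto simp: vpos_eq_iff\<close>)

text \<open>The case distinction merges into a difference of two indicators, because the inverse of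
  \<open>e\<close> ends where \<open>e\<close> starts; regularity replaces every degree by
  \<open>k\<close>.\<close>

lemma grover_entry_nth:
  assumes i: "i < 2 * m" and j: "j < 2 * m"
  shows "grover_entry G arev (es ! i) (es ! j) = ix.grover i j"
proof -
  have ar: "es ! i \<in> arcs G" "es ! j \<in> arcs G" using i j nth_arc by auto
  have d: "deg G arev (head G (es ! j)) = k" using ar regular by (simp add: k_regular_def)
  have "i = ix_rv j \<longleftrightarrow> es ! j = arev (es ! i)"
    using ar i epos[of "arev (es ! j)"] epos_nth[OF i] by (metis arev_arev arev_in_arcs)
  moreover have "ix_org i = ix_ter j \<longleftrightarrow> head G (es ! j) = tail G (es ! i)"
    using ar by (auto simp: vpos_eq_iff)
  moreover have "head G (es ! j) = tail G (es ! i)" if "es ! j = arev (es ! i)"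
    using that ar by simp
  moreover have "deg G arev (tail G (es ! i)) = k" using ar regular by (simp add: k_regular_def)
  ultimately show ?thesis using d by (auto simp: grover_entry_def ix.grover_def)
qed

lemma pos_support_grover: "map_mat complex_of_real (pos_support (grover_mat G arev es ^\<^sub>m 3)) = ix.Supp"
proof -
  let ?U = "grover_mat G arev es"
  have U: "?U \<in> carrier_mat (2 * m) (2 * m)" by (simp add: grover_mat_def length_es)
  have e1: "?U $$ (i, j) = ix.grover i j" if "i < 2 * m" "j < 2 * m" for i j
    using that by (simp add: grover_mat_def length_es grover_entry_nth)
  have e2: "(?U * ?U) $$ (i, j) = ix.grover2 i j" if "i < 2 * m" "j < 2 * m" for i j
    using that U by (simp add: scalar_prod_def e1 ix.grover2_def atLeast0LessThan)
  have e3: "(?U * (?U * ?U)) $$ (i, j) = ix.grover3 i j" if "i < 2 * m" "j < 2 * m" for i j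
  proof -
    have "(?U * (?U * ?U)) $$ (i, j) = (\<Sum>h = 0..<2 * m. ?U $$ (i, h) * (?U * ?U) $$ (h, j))"
      using that U by (simp add: scalar_prod_def)
    also have "\<dots> = ix.grover3 i j"
      unfolding ix.grover3_def atLeast0LessThan by (rule sum.cong) (use that in \<open>simp_all add: e1 e2 del: index_mult_mat(1)\<close>)
    finally show ?thesis .
  qed
  \<comment> \<open>The matrix power nests to the left, while \<open>grover3\<close> applies
    \<open>grover\<close> from the left to \<open>grover2\<close>; hence the reassociation.\<close>
  have "?U ^\<^sub>m 3 = ?U * (?U * ?U)"
    using U by (simp add: numeral_3_eq_3 assoc_mult_mat[of _ "2 * m" "2 * m" _ "2 * m" _ "2 * m"])
  then show ?thesis
    using U by (intro eq_matI) (simp_all del: index_mult_mat(1) add: pos_support_def e3 ix.Supp_def)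
qed

lemma adjacency_mat_eq: "map_mat complex_of_real (adjacency_mat G vs) = ix.Adj"
proof (rule eq_matI)
  fix i j assume "i < dim_row ix.Adj" "j < dim_col ix.Adj"
  then have ij: "i < n" "j < n" by auto
  have "{e. e < 2 * m \<and> ix_org e = i \<and> ix_ter e = j} =
      {e. e < 2 * m \<and> tail G (es ! e) = vs ! i \<and> head G (es ! e) = vs ! j}"
    using ij vpos vpos_nth nth_arc by (auto dest: tail_in_verts head_in_verts)
  then have "card {e \<in> arcs G. tail G e = vs ! i \<and> head G e = vs ! j} = of_bool (ix.adj i j)"
    using card_nth_es[of "\<lambda>e. tail G e = vs ! i \<and> head G e = vs ! j"] ix.card_arcs_between[of i j]
    by simp
  then show "map_mat complex_of_real (adjacency_mat G vs) $$ (i, j) = ix.Adj $$ (i, j)"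
    using ij by (simp add: adjacency_mat_def length_vs ix.index_mats)
qed (auto simp: adjacency_mat_def length_vs)

end

text \<open>The multiset equation carries the counts: the adjacency matrix has \<open>n\<close>
  eigenvalues with multiplicity, and each contributes two values.\<close>

theorem corollary5p4:
  fixes G :: "('a, 'b) pre_digraph"
    and arev :: "'b \<Rightarrow> 'b"
    and vs :: "'a list" and es :: "'b list"
    and k n m :: nat
  assumes "fin_digraph G" and "bidirected_digraph G arev"
    and "connected G"
    and "k_regular G arev k" and "k > 2"
    and "girth G arev > 4"
    and "n = card (verts G)" and "m = card (uedges G arev)"
    and "distinct vs" and "set vs = verts G"
    and "distinct es" and "set es = arcs G"
  defines "S \<equiv> \<lambda>l::complex. l * (l ^ 2 - 3 * of_nat k + 4)"
    and "R \<equiv> \<lambda>l::complex. csqrt (l ^ 6 - 2 * (3 * of_nat k - 2) * l ^ 4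
            + (13 * of_nat k ^ 2 - 24 * of_nat k + 16) * l ^ 2
            - 8 * (of_nat k - 1) * (of_nat k ^ 2 - 2 * of_nat k + 2))"
  shows "eigenvalues (pos_support (grover_mat G arev es ^\<^sub>m 3)) =
      (\<Sum>l\<in>#eigenvalues (adjacency_mat G vs). {# (S l + R l) / 2, (S l - R l) / 2 #})
      + replicate_mset (m - n) 2 + replicate_mset (m - n) (- 2)"
proof -
  interpret bidirected_digraph G arev by fact
  interpret enumerated_graph G arev vs es k n m
    by unfold_locales (fact assms)+
  obtain as where as: "char_poly ix.Adj = (\<Prod>a\<leftarrow>as. [:- a, 1:])" and len: "length as = n"
    using char_poly_factorized[OF ix.carriers(4)] by blast
  have "proots (\<Prod>a\<leftarrow>as. [:- a, 1:]) = mset as" for as :: "complex list"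
  proof (induction as)
    case (Cons a as)
    have "(\<Prod>a\<leftarrow>as. [:- a, 1:]) \<noteq> (0 :: complex poly)" by (auto simp: prod_list_zero_iff)
    then show ?case using Cons by (simp add: proots_mult del: mult_pCons_left)
  qed simp
  then have evA: "eigenvalues (adjacency_mat G vs) = mset as"
    by (simp add: eigenvalues_def adjacency_mat_eq as)
  \<comment> \<open>The quadratic factor is split by Vieta: its roots have sum \<open>S a\<close>,
    and \<open>(S a)^2 - (R a)^2\<close> is four times its constant coefficient. Only the square of
    \<open>R a\<close> enters, so the branch of the root does not matter.\<close>
  define p where "p = (\<lambda>a. [:- ((S a + R a) / 2), 1:] * [:- ((S a - R a) / 2), 1:])"
  have quad: "[:(a\<^sup>2 - 2 * (of_nat k - 1)) * (a\<^sup>2 - of_nat k ^ 2 + 2 * of_nat k - 2),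
      - (a * (a\<^sup>2 - 3 * of_nat k + 4)), 1:] = p a" for a
  proof -
    have "(S a + R a) / 2 * ((S a - R a) / 2) = (S a ^ 2 - R a ^ 2) / 4"
      by (simp add: power2_eq_square field_simps)
    also have "\<dots> = (a\<^sup>2 - 2 * (of_nat k - 1)) * (a\<^sup>2 - of_nat k ^ 2 + 2 * of_nat k - 2)"
      unfolding R_def S_def power2_csqrt by (simp add: power2_eq_square eval_nat_numeral field_simps)
    finally show ?thesis by (simp add: p_def S_def field_simps)
  qed
  \<comment> \<open>Root multisets add over products of nonzero polynomials.\<close>
  have p0: "p a \<noteq> 0" for a by (simp add: p_def del: mult_pCons_left mult_pCons_right)
  have prp: "proots (\<Prod>a\<leftarrow>as. p a) = (\<Sum>l\<in>#mset as. {# (S l + R l) / 2, (S l - R l) / 2 #})"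
    for as
  proof (induction as)
    case (Cons a as)
    have "(\<Prod>a\<leftarrow>as. p a) \<noteq> 0" using p0 by (auto simp: prod_list_zero_iff)
    moreover have "proots (p a) = {# (S a + R a) / 2, (S a - R a) / 2 #}"
      by (simp add: p_def proots_mult del: mult_pCons_left mult_pCons_right)
    ultimately show ?case using Cons p0[of a] by (simp add: proots_mult)
  qed simp
  \<comment> \<open>The factor \<open>x^2 - 4\<close> supplies the eigenvalues 2 and -2 in equal
    number.\<close>
  have "proots ([:- 2, 1:] * [:2, 1 :: complex:]) = {#2, - 2#}"
    by (subst proots_mult) auto
  then have "proots [:- 4, 0, 1 :: complex:] = {#2, - 2#}" by simp
  then have pr4: "proots ([:- 4, 0, 1 :: complex:] ^ (m - n)) = replicate_mset (m - n) 2 + replicate_mset (m - n) (- 2)"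
    by (simp add: proots_power multiset_eq_iff)
  have "char_poly ix.Supp = [:- 4, 0, 1:] ^ (m - n) * (\<Prod>a\<leftarrow>as. p a)"
    unfolding ix.char_poly_Supp[OF as len] quad ..
  moreover have "(\<Prod>a\<leftarrow>as. p a) \<noteq> 0" using p0 by (auto simp: prod_list_zero_iff)
  ultimately have "proots (char_poly ix.Supp) = proots ([:- 4, 0, 1:] ^ (m - n)) + proots (\<Prod>a\<leftarrow>as. p a)"
    by (simp add: proots_mult)
  then show ?thesis
    unfolding evA pr4 prp by (simp add: eigenvalues_def pos_support_grover)
qed

end
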